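(* Let $\xi$ be an extremal real number and let $\gamma=(1+\sqrt5)/2$. There is a value of $c>0$ such that the inequality $$|\xi-\alpha|\le c\,H(\alpha)^{-2\gamma^2}$$ has infinitely many solutions in algebraic numbers $\alpha\in\mathbb{C}$ of degree $2$ over $\mathbb{Q}$, and another value of $c>0$ such that the same inequality has no solution in algebraic numbers $\alpha\in\mathbb{C}$ of degree at most $2$ over $\mathbb{Q}$.
   Context: A real number $\xi$ is called extremal if it is neither rational nor quadratic irrational (i.e. not algebraic over $\mathbb{Q}$ of degree at most $2$) and there exists a constant $c'>0$ such that, for every real number $X\ge 1$, the inequalities $|x_0|\le X$, $|x_0\xi-x_1|\le c'X^{-1/\gamma}$, $|x_0\xi^2-x_2|\le c'X^{-1/\gamma}$ have a non-zero solution $(x_0,x_1,x_2)\in\mathbb{Z}^3$, where $\gamma=(1+\sqrt5)/2$. The height $H(P)$ of a polynomial $P\in\mathbb{R}[T]$ is the maximum of the absolute values of its coefficients, and the height $H(\alpha)$ of an algebraic number $\alpha$ is the height of its irreducible polynomial over $\mathbb{Z}$ (primitive integer polynomial, irreducible over $\mathbb Q$, having $\alpha$ as a root). *)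

theory Defs
  imports "HOL-Computational_Algebra.Computational_Algebra"
begin

definition golden_ratio :: real
  where "golden_ratio = (1 + sqrt 5) / 2"

definition poly_height :: "real poly \<Rightarrow> real"
  where "poly_height P = Max ((\<lambda>i. \<bar>coeff P i\<bar>) ` {..degree P})"

text \<open>The irreducible polynomial over the integers is determined only up to sign;
  the sign is fixed by asking for a positive leading coefficient.\<close>

definition is_irred_int_poly_of :: "'a::field_char_0 \<Rightarrow> int poly \<Rightarrow> bool"
  where "is_irred_int_poly_of x p \<longleftrightarrow>
    content p = 1 \<and> lead_coeff p > 0 \<and>
    irreducible (map_poly rat_of_int p) \<and> poly (map_poly of_int p) x = 0"

context
begin

private lemma rat_poly_mult:
  "map_poly rat_of_int (p * q) = map_poly rat_of_int p * map_poly rat_of_int q"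
  by (intro poly_eqI) (simp add: coeff_map_poly coeff_mult)

private lemma of_rat_poly_mult:
  "map_poly of_rat (p * q) = (map_poly of_rat p * map_poly of_rat q :: 'a::field_char_0 poly)"
  by (intro poly_eqI) (simp add: coeff_map_poly coeff_mult of_rat_sum of_rat_mult)

private lemma of_rat_poly_add:
  "map_poly of_rat (p + q) = (map_poly of_rat p + map_poly of_rat q :: 'a::field_char_0 poly)"
  by (intro poly_eqI) (simp add: coeff_map_poly of_rat_add)

private lemma of_rat_poly_of_int:
  "map_poly of_rat (map_poly rat_of_int p) = (map_poly of_int p :: 'a::field_char_0 poly)"
  by (intro poly_eqI) (simp add: coeff_map_poly)

private lemma clear_denominators:
  "\<exists>d p. d \<noteq> 0 \<and> map_poly rat_of_int p = smult (rat_of_int d) m"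
proof (induction m)
  case 0
  show ?case by (rule exI[of _ 1], rule exI[of _ 0]) simp
next
  case (pCons a m)
  then obtain d p where d: "d \<noteq> 0" "map_poly rat_of_int p = smult (rat_of_int d) m"
    by blast
  obtain n k where nk: "quotient_of a = (n, k)" by fastforce
  have k: "k > 0" using quotient_of_denom_pos[OF nk] .
  have a: "a = rat_of_int n / rat_of_int k" using quotient_of_div[OF nk] .
  have "map_poly rat_of_int (pCons (n * d) (smult k p)) = smult (rat_of_int (k * d)) (pCons a m)"
  proof -
    have "map_poly rat_of_int (smult k p) = smult (rat_of_int k) (map_poly rat_of_int p)"
      by (intro poly_eqI) (simp add: coeff_map_poly)
    then show ?thesis
      using k by (simp add: map_poly_pCons d a)
  qed
  moreover have "k * d \<noteq> 0" using k d by simp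
  ultimately show ?case by blast
qed

lemma ex1_irred_int_poly:
  fixes x :: "'a::field_char_0"
  assumes "algebraic x"
  shows "\<exists>!p. is_irred_int_poly_of x p"
proof -
  define R where "R = map_poly rat_of_int"
  define E where "E r = poly (map_poly of_rat r) x" for r
  have R_mult: "R (p * q) = R p * R q" for p q by (simp add: R_def rat_poly_mult)
  have R_smult: "R (smult c p) = smult (of_int c) (R p)" for c p
    by (intro poly_eqI) (simp add: R_def coeff_map_poly)
  have R_inj: "R p = R q \<longleftrightarrow> p = q" for p q
    by (simp add: R_def poly_eq_iff coeff_map_poly)
  have E_mult: "E (p * q) = E p * E q" for p q by (simp add: E_def of_rat_poly_mult)
  have E_add: "E (p + q) = E p + E q" for p q by (simp add: E_def of_rat_poly_add)
  have E_const: "E [:c:] = of_rat c" for c by (simp add: E_def map_poly_pCons)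
  have ER: "E (R p) = poly (map_poly of_int p) x" for p
    by (simp add: E_def R_def of_rat_poly_of_int)
  from assms obtain p0 where "p0 \<noteq> 0" "poly (map_poly of_int p0) x = 0"
    by (rule algebraicE')
  then have "R p0 \<noteq> 0 \<and> E (R p0) = 0"
    using R_inj[of p0 0] ER[of p0] by (auto simp: R_def)
  then obtain m where m: "m \<noteq> 0" "E m = 0"
    and min: "\<And>r. r \<noteq> 0 \<Longrightarrow> E r = 0 \<Longrightarrow> degree m \<le> degree r"
    using exists_least_iff[of "\<lambda>n. \<exists>r. r \<noteq> 0 \<and> E r = 0 \<and> degree r = n"]
    by (metis linorder_not_le)
  have m_dvd: "m dvd r" if "E r = 0" for r
  proof -
    have "E (r mod m) = 0"
      using that E_add[of "m * (r div m)" "r mod m"] by (simp add: E_mult m)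
    then show ?thesis
      using min[of "r mod m"] degree_mod_less[OF m(1), of r] by (metis dvd_eq_mod_eq_0 leD)
  qed
  have unit: "E r \<noteq> 0" if u: "r dvd 1" for r
  proof -
    from u obtain s where "1 = r * s" by (rule dvdE)
    then have "E r * E s = E 1" by (metis E_mult)
    then show ?thesis using E_const[of 1] by (auto simp: one_pCons)
  qed
  have irr_m: "irreducible m"
  proof (rule irreducibleI)
    show "m \<noteq> 0" by (fact m)
    show "\<not> m dvd 1" using unit m by blast
    fix a b assume ab: "m = a * b"
    have *: "v dvd 1" if uv: "m = u * v" "E u = 0" for u v
    proof -
      obtain k where "u = m * k" using m_dvd[OF uv(2)] by (rule dvdE)
      with uv(1) have "m * 1 = m * (k * v)" by (simp add: ac_simps)
      then have "1 = k * v" using m(1) by (metis mult_left_cancel)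
      then show ?thesis by (metis dvd_triv_right)
    qed
    have "E a = 0 \<or> E b = 0" using ab m by (simp add: E_mult)
    then show "a dvd 1 \<or> b dvd 1" using *[of a b] *[of b a] ab by (auto simp: mult.commute)
  qed
  have ex: "\<exists>p. is_irred_int_poly_of x p"
  proof -
    obtain d p where d: "d \<noteq> 0" "R p = smult (rat_of_int d) m"
      using clear_denominators unfolding R_def by blast
    have p: "p \<noteq> 0" using d m by (auto simp: R_def)
    define q where "q = smult (sgn (lead_coeff p)) (primitive_part p)"
    have lc: "lead_coeff p = content p * lead_coeff (primitive_part p)"
      by (metis content_times_primitive_part lead_coeff_smult)
    have c: "content p > 0"
      using p normalize_content[of p] content_eq_zero_iff[of p]
      by (metis abs_of_nonneg abs_ge_zero normalize_int_def order_le_less)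
    define g where "g = sgn (lead_coeff p) * content p"
    have g: "g \<noteq> 0" using p c by (simp add: g_def sgn_0_0)
    have "sgn (lead_coeff p) * sgn (lead_coeff p) = 1"
      using p by (simp add: sgn_if)
    then have "g * sgn (lead_coeff p) = content p"
      by (metis g_def mult.commute mult.left_commute mult_1_right)
    then have "smult g q = p"
      by (simp add: q_def)
    then have gq: "smult (of_int g) (R q) = smult (of_int d) m"
      by (metis R_smult d(2))
    have "R q = smult (1 / of_int g) (smult (of_int g) (R q))"
      using g by simp
    then have Rq: "R q = smult (of_int d / of_int g) m"
      by (simp only: gq smult_smult) simp
    define e where "e = rat_of_int d / of_int g"
    have e: "e \<noteq> 0" using d g by (simp add: e_def)
    have Rq': "R q = [:e:] * m" using Rq by (simp add: e_def)
    have "[:e:] dvd 1" using e by (simp add: is_unit_const_poly_iff dvd_field_iff)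
    then have "irreducible (R q)"
      unfolding Rq' using irr_m by (simp only: irreducible_mult_unit_left)
    moreover have "E (R q) = 0" by (simp only: Rq' E_mult m mult_zero_right)
    moreover have "content q = 1" using p by (simp add: q_def sgn_if)
    moreover have "lead_coeff q > 0"
    proof -
      have "lead_coeff (primitive_part p) \<noteq> 0"
        using p by (metis leading_coeff_0_iff primitive_part_eq_0_iff)
      moreover have "sgn (lead_coeff p) = sgn (lead_coeff (primitive_part p))"
        using c unfolding lc by (simp add: sgn_mult)
      then have "lead_coeff q = sgn (lead_coeff (primitive_part p)) * lead_coeff (primitive_part p)"
        by (simp only: q_def lead_coeff_smult)
      then have "lead_coeff q = \<bar>lead_coeff (primitive_part p)\<bar>"
        by (simp only: mult_sgn_abs abs_sgn mult.commute)
      ultimately show ?thesis by (metis zero_less_abs_iff)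
    qed
    ultimately show ?thesis
      unfolding is_irred_int_poly_of_def by (intro exI[of _ q])
        (simp add: ER[symmetric], simp add: R_def)
  qed
  have uniq: "p = q" if pq_irr: "is_irred_int_poly_of x p" "is_irred_int_poly_of x q" for p q
  proof -
    have assoc: "\<exists>c. c \<noteq> 0 \<and> R r = smult c m" if "is_irred_int_poly_of x r" for r
    proof -
      from that have r: "irreducible (R r)" "E (R r) = 0"
        by (simp_all add: is_irred_int_poly_of_def ER) (simp add: R_def)
      obtain k where k: "R r = m * k" using m_dvd[OF r(2)] by (rule dvdE)
      then have "k dvd 1" using r(1) irreducibleD[of "R r" m k] irreducible_not_unit[OF irr_m] by blast
      then obtain c where "k = [:c:]" "c \<noteq> 0"
        by (auto simp: is_unit_poly_iff dvd_field_iff)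
      then show ?thesis using k by auto
    qed
    obtain c c' where c: "c \<noteq> 0" "R p = smult c m" "c' \<noteq> 0" "R q = smult c' m"
      using assoc pq_irr by blast
    obtain a b where ab: "quotient_of (c / c') = (a, b)" by fastforce
    have b: "b > 0" using quotient_of_denom_pos[OF ab] .
    have "c / c' = of_int a / of_int b" using quotient_of_div[OF ab] .
    then have "of_int b * c = of_int a * c'" using b c by (simp add: field_simps)
    then have "R (smult b p) = R (smult a q)" by (simp add: R_smult c)
    then have eq: "smult b p = smult a q" by (simp add: R_inj)
    have pq: "content p = 1" "content q = 1" "lead_coeff p > 0" "lead_coeff q > 0"
      using pq_irr by (simp_all add: is_irred_int_poly_of_def)
    have "\<bar>b\<bar> = \<bar>a\<bar>" using arg_cong[OF eq, of content] pq by simp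
    moreover have "b * lead_coeff p = a * lead_coeff q"
      using arg_cong[OF eq, of lead_coeff] by (simp only: lead_coeff_smult)
    then have "a * lead_coeff q > 0" using mult_pos_pos[OF b pq(3)] by simp
    then have "a > 0" using pq(4) by (simp add: zero_less_mult_iff)
    ultimately have "a = b" using b by simp
    then show ?thesis using eq b by (simp add: poly_eq_iff)
  qed
  show ?thesis using ex uniq by blast
qed

end

text \<open>The following three are meaningful only for algebraic arguments.\<close>

definition irred_int_poly :: "'a::field_char_0 \<Rightarrow> int poly"
  where "irred_int_poly x = (THE p. is_irred_int_poly_of x p)"

definition alg_degree :: "'a::field_char_0 \<Rightarrow> nat"
  where "alg_degree x = degree (irred_int_poly x)"

definition alg_height :: "'a::field_char_0 \<Rightarrow> real"
  where "alg_height x = poly_height (map_poly real_of_int (irred_int_poly x))"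

definition extremal :: "real \<Rightarrow> bool"
  where "extremal \<xi> \<longleftrightarrow>
    \<not> (algebraic \<xi> \<and> alg_degree \<xi> \<le> 2) \<and>
    (\<exists>c>0. \<forall>X\<ge>1. \<exists>x0 x1 x2 :: int. (x0, x1, x2) \<noteq> (0, 0, 0) \<and>
      \<bar>real_of_int x0\<bar> \<le> X \<and>
      \<bar>of_int x0 * \<xi> - of_int x1\<bar> \<le> c * X powr (- 1 / golden_ratio) \<and>
      \<bar>of_int x0 * \<xi>\<^sup>2 - of_int x2\<bar> \<le> c * X powr (- 1 / golden_ratio))"

end

theory Submission
  imports Defs "HOL-Library.Infinite_Set"
begin

text \<open>
  Write \<open>X = |x\<^sub>0|\<close> for the size of an integer point \<open>x = (x\<^sub>0, x\<^sub>1, x\<^sub>2)\<close> and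
  \<open>L = max (|x\<^sub>0 \<xi> - x\<^sub>1|, |x\<^sub>0 \<xi>\<^sup>2 - x\<^sub>2|)\<close> for its error. A point is close to a multiple of
  \<open>(1, \<xi>, \<xi>\<^sup>2)\<close>, which lies on the conic \<open>x\<^sub>0 x\<^sub>2 = x\<^sub>1\<^sup>2\<close>, so the determinant \<open>x\<^sub>0 x\<^sub>2 - x\<^sub>1\<^sup>2\<close> of one
  point and the determinant of three points are integers bounded in terms of sizes and errors;
  where they do not vanish, sizes and errors cannot both be small. The whole proof plays these
  inequalities against the upper bound \<open>L\<^sub>i \<le> c X\<^sub>i\<^sub>+\<^sub>1\<^bsup>-1/\<gamma>\<^esup>\<close> that extremality gives for the sequence of
  minimal points.

  Three consecutive minimal points are infinitely often independent, since otherwise all late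
  ones would lie in one rational plane and \<open>\<xi>\<close> would be quadratic or rational. At such a turn
  the exponents leave no room: the middle point \<open>y\<close> of size \<open>Y\<close> has error of order \<open>1/Y\<close>. Between
  two turns the points stay in one plane, in which consecutive minimal points form a lattice
  basis, so their cross products keep the same norm; this forces the next middle point to have
  size at most of order \<open>Y\<^sup>\<gamma>\<close>. The middle points form a sequence \<open>y\<^sub>k\<close> with \<open>Y\<^sub>k\<^sub>+\<^sub>1 \<le> C Y\<^sub>k\<^sup>\<gamma>\<close>, error at
  most \<open>C / Y\<^sub>k\<close>, nonzero determinants, and any three consecutive members independent
  (\<open>extremal_sequence_of_turns\<close>). Only this sequence enters the rest of the proof.

  Lower bound. Let \<open>P\<close> be a nonzero integer polynomial of degree at most 2 and norm \<open>H\<close>. Its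
  coefficient vector is not orthogonal to all of \<open>y\<^sub>k\<close>, \<open>y\<^sub>k\<^sub>+\<^sub>1\<close>, \<open>y\<^sub>k\<^sub>+\<^sub>2\<close>, and the scalar product with
  \<open>y\<^sub>n\<close> differs from \<open>Y\<^sub>n P(\<xi>)\<close> by \<open>O(H / Y\<^sub>n)\<close>. Choosing \<open>Y\<^sub>k\<close> as a suitable multiple of \<open>H\<close>, up to
  the exponent \<open>\<gamma>\<close>, gives \<open>|P(\<xi>)| \<ge> a H\<^bsup>-\<gamma>\<^sup>3\<^esup>\<close>. For the minimal polynomial of \<open>\<alpha>\<close> the mean
  value estimate costs one more factor \<open>H\<close>, and \<open>\<gamma>\<^sup>3 + 1 = 2 \<gamma>\<^sup>2\<close>.

  Upper bound. The polynomial with coefficient vector \<open>y\<^sub>k \<times> y\<^sub>k\<^sub>+\<^sub>1\<close> has value of order at most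
  \<open>1 / (Y\<^sub>k Y\<^sub>k\<^sub>+\<^sub>1)\<close> at \<open>\<xi>\<close>, derivative of order at least \<open>Y\<^sub>k\<^sub>+\<^sub>1 / Y\<^sub>k\<close> there (this is where the determinant
  of \<open>y\<^sub>k\<close> enters), and norm of order at most \<open>Y\<^sub>k\<^sub>+\<^sub>1 / Y\<^sub>k\<close>, hence at most \<open>Y\<^sub>k\<^sub>+\<^sub>1\<^bsup>1/\<gamma>\<^sup>2\<^esup>\<close>. So it has a
  root \<open>\<alpha>\<close> at distance at most of order \<open>Y\<^sub>k\<^sub>+\<^sub>1\<^bsup>-2\<^esup>\<close>, which is \<open>H(\<alpha>)\<^bsup>-2\<gamma>\<^sup>2\<^esup>\<close> up to a constant. This
  root is not rational for large \<open>k\<close>, because rational numbers obey a stronger lower bound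
  (\<open>rational_lower_bound\<close>).

  Powers of \<open>\<gamma>\<close> in exponents are reduced by \<open>\<gamma>\<^sup>2 = \<gamma> + 1\<close>: thus \<open>1/\<gamma>\<close>, \<open>1/\<gamma>\<^sup>2\<close> and \<open>\<gamma>\<^sup>3\<close> appear below as
  \<open>\<gamma> - 1\<close>, \<open>2 - \<gamma>\<close> and \<open>2 \<gamma> + 1\<close>.
\<close>

section \<open>The golden ratio\<close>

abbreviation (input) \<gamma> :: real where "\<gamma> \<equiv> golden_ratio"

lemma golden_ratio_gt_1: "golden_ratio > 1"
  by (simp add: golden_ratio_def real_less_rsqrt)

lemma golden_ratio_square: "golden_ratio\<^sup>2 = golden_ratio + 1"
  by (simp add: golden_ratio_def power2_eq_square field_simps)

lemma inverse_golden_ratio: "1 / golden_ratio = golden_ratio - 1"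
  using golden_ratio_square golden_ratio_gt_1 by (simp add: field_simps power2_eq_square)

lemma golden_ratio_bounds: "1.6 < golden_ratio" "golden_ratio < 1.7"
proof -
  have "2.2 < sqrt 5" by (rule real_less_rsqrt) (simp add: power2_eq_square)
  moreover have "sqrt 5 < 2.4" by (rule real_less_lsqrt) (simp_all add: power2_eq_square)
  ultimately show "1.6 < golden_ratio" "golden_ratio < 1.7" by (simp_all add: golden_ratio_def)
qed

section \<open>Minimal polynomials of numbers of degree at most two\<close>

lemma irred_int_poly_is_irred:
  assumes "algebraic x"
  shows "is_irred_int_poly_of x (irred_int_poly x)"
  unfolding irred_int_poly_def using ex1_irred_int_poly[OF assms] by (rule theI')

lemma alg_degree_pos:
  assumes "algebraic x"
  shows "alg_degree x > 0"
proof (rule ccontr)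
  assume "\<not> alg_degree x > 0"
  then have "degree (irred_int_poly x) = 0" by (simp add: alg_degree_def)
  then obtain a where a: "irred_int_poly x = [:a:]" by (metis degree_eq_zeroE)
  with irred_int_poly_is_irred[OF assms] have "a > 0" "of_int a = (0::'a)"
    by (auto simp: is_irred_int_poly_of_def map_poly_pCons)
  then show False by simp
qed

lemma of_rat_poly_add_mult:
  "poly (map_poly of_rat (p + q)) x = (poly (map_poly of_rat p) x + poly (map_poly of_rat q) x :: 'a::field_char_0)"
  "poly (map_poly of_rat (p * q)) x = (poly (map_poly of_rat p) x * poly (map_poly of_rat q) x :: 'a::field_char_0)"
proof -
  have "map_poly of_rat (p + q) = (map_poly of_rat p + map_poly of_rat q :: 'a poly)"
    by (intro poly_eqI) (simp add: coeff_map_poly of_rat_add)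
  then show "poly (map_poly of_rat (p + q)) x = (poly (map_poly of_rat p) x + poly (map_poly of_rat q) x :: 'a)"
    by simp
  have "map_poly of_rat (p * q) = (map_poly of_rat p * map_poly of_rat q :: 'a poly)"
    by (intro poly_eqI) (simp add: coeff_map_poly coeff_mult of_rat_sum of_rat_mult)
  then show "poly (map_poly of_rat (p * q)) x = (poly (map_poly of_rat p) x * poly (map_poly of_rat q) x :: 'a)"
    by simp
qed

text \<open>The rational polynomials vanishing at \<open>x\<close> are the multiples of one of least degree; an irreducible
  polynomial among them is a generator as well.\<close>

lemma irred_int_poly_dvd:
  fixes x :: "'a::field_char_0"
  assumes q: "is_irred_int_poly_of x q" and p: "poly (map_poly of_int p) x = 0"
  shows "map_poly rat_of_int q dvd map_poly rat_of_int p"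
proof -
  define E where "E r = poly (map_poly of_rat r) x" for r
  have E_add: "E (r + s) = E r + E s" and E_mult: "E (r * s) = E r * E s" for r s
    by (simp_all add: E_def of_rat_poly_add_mult)
  have E_int: "E (map_poly rat_of_int r) = poly (map_poly of_int r) x" for r
  proof -
    have "map_poly of_rat (map_poly rat_of_int r) = (map_poly of_int r :: 'a poly)"
      by (intro poly_eqI) (simp add: coeff_map_poly)
    then show ?thesis by (simp add: E_def)
  qed
  have Eq: "E (map_poly rat_of_int q) = 0" and irr: "irreducible (map_poly rat_of_int q)"
    using q by (simp_all add: E_int is_irred_int_poly_of_def)
  then have "map_poly rat_of_int q \<noteq> 0 \<and> E (map_poly rat_of_int q) = 0" by auto
  then obtain m where m: "m \<noteq> 0" "E m = 0"
    and min: "\<And>r. r \<noteq> 0 \<Longrightarrow> E r = 0 \<Longrightarrow> degree m \<le> degree r"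
    using exists_least_iff[of "\<lambda>n. \<exists>r. r \<noteq> 0 \<and> E r = 0 \<and> degree r = n"]
    by (metis linorder_not_le)
  have m_dvd: "m dvd r" if "E r = 0" for r
  proof -
    have "E (r mod m) = 0"
      using that E_add[of "m * (r div m)" "r mod m"] by (simp add: E_mult m)
    then show ?thesis
      using min[of "r mod m"] degree_mod_less[OF m(1), of r] by (metis dvd_eq_mod_eq_0 leD)
  qed
  obtain k where k: "map_poly rat_of_int q = m * k" using m_dvd[OF Eq] by (rule dvdE)
  have "\<not> m dvd 1"
  proof
    assume "m dvd 1"
    then obtain s where "1 = m * s" by (rule dvdE)
    then have "E 1 = 0" using m by (metis E_mult mult_zero_left)
    then show False by (simp add: E_def one_pCons map_poly_pCons)
  qed
  then have "k dvd 1" using irreducibleD[OF irr k] by blast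
  then have "map_poly rat_of_int q dvd m" unfolding k by (metis dvd_refl mult_unit_dvd_iff)
  then show ?thesis using m_dvd[of "map_poly rat_of_int p"] p by (simp add: E_int dvd_trans)
qed

lemma degree_rat_of_int: "degree (map_poly rat_of_int p) = degree p"
  by (intro degree_map_poly) auto

lemma alg_degree_le:
  fixes x :: "'a::field_char_0"
  assumes "p \<noteq> 0" "poly (map_poly of_int p) x = 0"
  shows "algebraic x \<and> alg_degree x \<le> degree p"
proof -
  have "map_poly of_int p \<noteq> (0 :: 'a poly)"
    using assms(1) by (auto simp: poly_eq_iff coeff_map_poly)
  then have "algebraic x" using assms(2) by (intro algebraicI) (auto simp: coeff_map_poly)
  then have "map_poly rat_of_int (irred_int_poly x) dvd map_poly rat_of_int p"
    using irred_int_poly_dvd irred_int_poly_is_irred assms by blast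
  moreover have "map_poly rat_of_int p \<noteq> 0"
    using assms(1) by (auto simp: poly_eq_iff coeff_map_poly)
  ultimately have "degree (irred_int_poly x) \<le> degree p"
    by (metis dvd_imp_degree_le degree_rat_of_int)
  with \<open>algebraic x\<close> show ?thesis by (simp add: alg_degree_def)
qed

text \<open>A polynomial of the same degree as the minimal polynomial is a rational multiple of it. The factor
  is an integer because the minimal polynomial has content 1, so no coefficient gets smaller in absolute value.\<close>

lemma alg_height_le:
  fixes x :: "'a::field_char_0"
  assumes p: "p \<noteq> 0" "poly (map_poly of_int p) x = 0" and deg: "degree p \<le> alg_degree x"
    and H: "\<And>i. real_of_int \<bar>coeff p i\<bar> \<le> H"
  shows "alg_height x \<le> H"
proof -
  define q where "q = irred_int_poly x"
  have alg: "algebraic x" and le: "alg_degree x \<le> degree p" using alg_degree_le[OF p] by auto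
  have q: "is_irred_int_poly_of x q" using irred_int_poly_is_irred[OF alg] by (simp add: q_def)
  then obtain k where k: "map_poly rat_of_int p = map_poly rat_of_int q * k"
    using irred_int_poly_dvd p(2) by (blast elim: dvdE)
  have nz: "map_poly rat_of_int p \<noteq> 0" using p(1) by (auto simp: poly_eq_iff coeff_map_poly)
  have "degree p = degree q" using deg le by (simp add: alg_degree_def q_def)
  moreover have "degree p = degree q + degree k"
    using k nz degree_mult_eq[of "map_poly rat_of_int q" k] by (metis degree_rat_of_int mult_zero_left mult_zero_right)
  ultimately obtain r where r: "k = [:r:]" using degree_eq_zeroE[of k] by auto
  obtain a b where ab: "quotient_of r = (a, b)" by fastforce
  have b: "b > 0" and rab: "r = of_int a / of_int b"
    using quotient_of_denom_pos[OF ab] quotient_of_div[OF ab] by auto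
  have eq: "smult b p = smult a q"
  proof (rule poly_eqI)
    fix i
    have "rat_of_int (coeff p i) = of_int (coeff q i) * r"
      using arg_cong[OF k, of "\<lambda>f. coeff f i"] r by (simp add: coeff_map_poly)
    then have "rat_of_int (b * coeff p i) = of_int (a * coeff q i)"
      using b rab by (simp add: field_simps)
    then show "coeff (smult b p) i = coeff (smult a q) i" by (simp only: of_int_eq_iff coeff_smult)
  qed
  have "content q = 1" using q by (simp add: is_irred_int_poly_of_def)
  then have "b * content p = \<bar>a\<bar>" using arg_cong[OF eq, of content] b by simp
  moreover have "content p \<ge> 1"
    using p(1) content_eq_zero_iff[of p] normalize_content[of p]
    by (smt (verit) normalize_int_def zero_less_abs_iff)
  ultimately have ba: "b \<le> \<bar>a\<bar>" using b by (metis mult.right_neutral mult_left_mono order_less_imp_le)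
  have le: "\<bar>coeff q i\<bar> \<le> \<bar>coeff p i\<bar>" for i
  proof -
    have "b * \<bar>coeff q i\<bar> \<le> \<bar>a\<bar> * \<bar>coeff q i\<bar>" using ba by (intro mult_right_mono) auto
    also have "\<dots> = b * \<bar>coeff p i\<bar>"
      using arg_cong[OF eq, of "\<lambda>f. \<bar>coeff f i\<bar>"] b by (simp add: abs_mult)
    finally show ?thesis using b by simp
  qed
  have "real_of_int \<bar>coeff q i\<bar> \<le> H" for i using le[of i] H[of i] by linarith
  then show ?thesis
    by (auto simp: alg_height_def poly_height_def coeff_map_poly simp flip: q_def)
qed

lemma alg_height_ge_coeff:
  assumes "algebraic x"
  shows "real_of_int \<bar>coeff (irred_int_poly x) i\<bar> \<le> alg_height x" "1 \<le> alg_height x"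
proof -
  let ?q = "irred_int_poly x"
  have deg: "degree (map_poly real_of_int ?q) = degree ?q" by (intro degree_map_poly) auto
  have *: "real_of_int \<bar>coeff ?q i\<bar> \<le> alg_height x" if "i \<le> degree ?q" for i
    unfolding alg_height_def poly_height_def deg
    by (rule Max_ge) (use that in \<open>auto simp: coeff_map_poly intro!: image_eqI[of _ _ i]\<close>)
  have "lead_coeff ?q \<ge> 1"
    using irred_int_poly_is_irred[OF assms] by (simp add: is_irred_int_poly_of_def)
  then show "1 \<le> alg_height x" using *[of "degree ?q"] by linarith
  then show "real_of_int \<bar>coeff ?q i\<bar> \<le> alg_height x"
    using *[of i] by (cases "i \<le> degree ?q") (auto simp: coeff_eq_0)
qed

lemma rational_if_alg_degree_1:
  fixes x :: "'a::field_char_0"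
  assumes "algebraic x" "alg_degree x = 1"
  obtains m n :: int where "n > 0" "coprime m n" "of_int n * x = of_int m"
proof -
  let ?q = "irred_int_poly x"
  obtain a b where ab: "?q = [:a, b:]"
    using assms(2) unfolding alg_degree_def by (elim degree1_coeffs)
  have q: "is_irred_int_poly_of x ?q" using irred_int_poly_is_irred[OF assms(1)] .
  then have "lead_coeff [:a, b:] > 0" by (simp only: is_irred_int_poly_of_def ab)
  moreover have "b \<noteq> 0" using ab assms(2) by (auto simp: alg_degree_def)
  ultimately have b: "b > 0" by simp
  have "gcd a b = 1" using q b by (simp add: is_irred_int_poly_of_def ab content_def cCons_def)
  then have "coprime (- a) b" by (simp add: coprime_iff_gcd_eq_1)
  moreover have "of_int b * x = of_int (- a)"
  proof -
    have "of_int a + x * of_int b = 0"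
      using q by (simp add: is_irred_int_poly_of_def ab map_poly_pCons)
    then show ?thesis by (metis add_eq_0_iff mult.commute of_int_minus minus_unique)
  qed
  ultimately show thesis using that b by blast
qed

lemma poly_degree_le_2:
  assumes "degree p \<le> 2"
  shows "p = [:coeff p 0, coeff p 1, coeff p 2:]"
proof (rule poly_eqI)
  fix i
  show "coeff p i = coeff [:coeff p 0, coeff p 1, coeff p 2:] i"
  proof (cases "i \<le> 2")
    case True
    then consider "i = 0" | "i = 1" | "i = 2" by linarith
    then show ?thesis by cases (simp_all add: numeral_2_eq_2)
  next
    case False
    then show ?thesis using assms by (simp add: coeff_eq_0 coeff_pCons split: nat.splits)
  qed
qed

text \<open>With roots \<open>a\<close>, \<open>b\<close> the value at \<open>\<xi>\<close> is \<open>q\<^sub>2 (\<xi> - a) (\<xi> - b)\<close> and the derivative is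
  \<open>q\<^sub>2 ((\<xi> - a) + (\<xi> - b))\<close>, so the nearer root is at distance at most twice their quotient. If
  \<open>q\<^sub>2\<close> vanishes, the distance of the only root is the quotient itself.\<close>

lemma complex_root_near:
  fixes q0 q1 q2 \<xi> :: real
  assumes "q1 + 2 * \<xi> * q2 \<noteq> 0"
  obtains \<alpha> :: complex where "of_real q0 + of_real q1 * \<alpha> + of_real q2 * \<alpha>\<^sup>2 = 0"
    "cmod (of_real \<xi> - \<alpha>) * \<bar>q1 + 2 * \<xi> * q2\<bar> \<le> 2 * \<bar>q0 + q1 * \<xi> + q2 * \<xi>\<^sup>2\<bar>"
proof (cases "q2 = 0")
  case True
  define r where "r = - q0 / q1"
  have q1: "q1 \<noteq> 0" using assms True by simp
  have "(\<xi> - r) * q1 = q0 + q1 * \<xi>" using q1 by (simp add: r_def field_simps)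
  then have "\<bar>\<xi> - r\<bar> * \<bar>q1\<bar> = \<bar>q0 + q1 * \<xi>\<bar>" by (metis abs_mult)
  moreover have "cmod (of_real \<xi> - of_real r) = \<bar>\<xi> - r\<bar>" by (simp flip: of_real_diff)
  moreover have "complex_of_real q0 + of_real q1 * of_real r = 0" using q1 by (simp add: r_def)
  ultimately show ?thesis using True by (intro that[of "of_real r"]) auto
next
  case False
  define s where "s = csqrt (of_real (q1\<^sup>2 - 4 * q0 * q2))"
  have s: "s * s = of_real (q1\<^sup>2 - 4 * q0 * q2)" by (simp add: s_def flip: power2_eq_square)
  define a b where "a = (s - of_real q1) / (2 * of_real q2)" and "b = (- s - of_real q1) / (2 * of_real q2)"
  then have ab: "2 * of_real q2 * a = s - of_real q1" "2 * of_real q2 * b = - s - of_real q1"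
    using False by simp_all
  have "2 * of_real q1 = 2 * (- (of_real q2 * (a + b)))" using ab by (simp add: distrib_left mult.assoc[symmetric])
  then have q1: "of_real q1 = - (of_real q2 * (a + b))" by (metis mult_cancel_left zero_neq_numeral)
  have "4 * of_real q2 * (of_real q2 * (a * b)) = (2 * of_real q2 * a) * (2 * of_real q2 * b)" by simp
  also have "\<dots> = of_real (q1\<^sup>2) - s * s" unfolding ab by (simp add: algebra_simps power2_eq_square)
  also have "\<dots> = 4 * of_real q2 * of_real q0" unfolding s by simp
  finally have q0: "of_real q0 = of_real q2 * (a * b)" using False by simp
  have factor: "of_real q0 + of_real q1 * t + of_real q2 * t\<^sup>2 = of_real q2 * ((t - a) * (t - b))" for t
    unfolding q0 q1 by (simp add: algebra_simps power2_eq_square)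
  have deriv: "of_real (q1 + 2 * \<xi> * q2) = of_real q2 * ((of_real \<xi> - a) + (of_real \<xi> - b))"
    by (simp add: q1 algebra_simps)
  have val: "\<bar>q0 + q1 * \<xi> + q2 * \<xi>\<^sup>2\<bar> = \<bar>q2\<bar> * (cmod (of_real \<xi> - a) * cmod (of_real \<xi> - b))"
    using arg_cong[OF factor[of "of_real \<xi>"], of cmod]
    by (simp only: norm_mult norm_of_real of_real_mult[symmetric] of_real_power[symmetric] of_real_add[symmetric])
  have der: "\<bar>q1 + 2 * \<xi> * q2\<bar> = \<bar>q2\<bar> * cmod ((of_real \<xi> - a) + (of_real \<xi> - b))"
    using arg_cong[OF deriv, of cmod] by (simp only: norm_mult norm_of_real)
  have near: "cmod u * (\<bar>q2\<bar> * cmod (u + v)) \<le> 2 * (\<bar>q2\<bar> * (cmod u * cmod v))" if "cmod u \<le> cmod v" for u v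
  proof -
    have "cmod u * (\<bar>q2\<bar> * cmod (u + v)) \<le> cmod u * (\<bar>q2\<bar> * (2 * cmod v))"
      using that norm_triangle_ineq[of u v] by (intro mult_left_mono) auto
    then show ?thesis by (simp add: mult_ac)
  qed
  show ?thesis
  proof (cases "cmod (of_real \<xi> - a) \<le> cmod (of_real \<xi> - b)")
    case True
    show ?thesis
    proof (rule that[of a])
      show "of_real q0 + of_real q1 * a + of_real q2 * a\<^sup>2 = 0" unfolding factor by simp
    qed (unfold val der, rule near[OF True])
  next
    case False
    show ?thesis
    proof (rule that[of b])
      show "of_real q0 + of_real q1 * b + of_real q2 * b\<^sup>2 = 0" unfolding factor by simp
      have "cmod (of_real \<xi> - b) \<le> cmod (of_real \<xi> - a)" using False by simp
      from near[OF this] show "cmod (of_real \<xi> - b) * \<bar>q1 + 2 * \<xi> * q2\<bar> \<le> 2 * \<bar>q0 + q1 * \<xi> + q2 * \<xi>\<^sup>2\<bar>"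
        unfolding val der by (simp only: add.commute mult.commute)
    qed
  qed
qed

section \<open>Integer points and their approximation error\<close>

type_synonym point = "int \<times> int \<times> int"

fun dot :: "point \<Rightarrow> point \<Rightarrow> int" where
  "dot (x0, x1, x2) (y0, y1, y2) = x0 * y0 + x1 * y1 + x2 * y2"

fun cross :: "point \<Rightarrow> point \<Rightarrow> point" where
  "cross (x0, x1, x2) (y0, y1, y2) = (x1 * y2 - x2 * y1, x2 * y0 - x0 * y2, x0 * y1 - x1 * y0)"

abbreviation det3 :: "point \<Rightarrow> point \<Rightarrow> point \<Rightarrow> int" where
  "det3 x y z \<equiv> dot (cross x y) z"

fun det2 :: "point \<Rightarrow> int" where
  "det2 (x0, x1, x2) = x0 * x2 - x1\<^sup>2"

fun lin_comb :: "int \<Rightarrow> point \<Rightarrow> int \<Rightarrow> point \<Rightarrow> point" where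
  "lin_comb a (x0, x1, x2) b (y0, y1, y2) = (a * x0 + b * y0, a * x1 + b * y1, a * x2 + b * y2)"

fun max_norm :: "point \<Rightarrow> real" where
  "max_norm (x0, x1, x2) = max \<bar>real_of_int x0\<bar> (max \<bar>real_of_int x1\<bar> \<bar>real_of_int x2\<bar>)"

fun size0 :: "point \<Rightarrow> real" where
  "size0 (x0, x1, x2) = \<bar>real_of_int x0\<bar>"

fun err :: "real \<Rightarrow> point \<Rightarrow> real" where
  "err \<xi> (x0, x1, x2) = max \<bar>x0 * \<xi> - x1\<bar> \<bar>x0 * \<xi>\<^sup>2 - x2\<bar>"

text \<open>Integer points also serve as coefficient vectors of polynomials of degree at most 2.\<close>

fun eval_at :: "real \<Rightarrow> point \<Rightarrow> real" where
  "eval_at \<xi> (p0, p1, p2) = p0 + p1 * \<xi> + p2 * \<xi>\<^sup>2"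

lemma size0_nonneg: "size0 x \<ge> 0" by (cases x) auto
lemma size0_eq_nat: "size0 x = real (nat \<bar>fst x\<bar>)" by (cases x) simp

lemma size0_less_imp: "size0 x < size0 y \<Longrightarrow> size0 x + 1 \<le> size0 y"
  unfolding size0_eq_nat by (metis Suc_leI add.commute of_nat_Suc of_nat_le_iff of_nat_less_iff)

lemma err_nonneg: "err \<xi> x \<ge> 0" by (cases x) auto
lemma max_norm_nonneg: "max_norm x \<ge> 0" by (cases x) auto

lemma max_norm_ge_1: "x \<noteq> (0, 0, 0) \<Longrightarrow> max_norm x \<ge> 1"
  by (cases x) auto

lemma abs_coord_le_max_norm:
  "\<bar>real_of_int x0\<bar> \<le> max_norm (x0, x1, x2)" "\<bar>real_of_int x1\<bar> \<le> max_norm (x0, x1, x2)"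
  "\<bar>real_of_int x2\<bar> \<le> max_norm (x0, x1, x2)"
  by auto

lemma dot_cross_self: "dot (cross x y) x = 0" "dot (cross x y) y = 0"
  by (cases x; cases y; simp add: algebra_simps)+

text \<open>A vector orthogonal to two independent points is parallel to their cross product. This
  lemma carries all the plane geometry below, without any rational span.\<close>

lemma orthogonal_iff_det3_eq_0:
  assumes v: "dot v x = 0" "dot v y = 0" "v \<noteq> (0, 0, 0)" and xy: "cross x y \<noteq> (0, 0, 0)"
  shows "dot v z = 0 \<longleftrightarrow> det3 x y z = 0"
proof -
  obtain x0 x1 x2 where x: "x = (x0, x1, x2)" by (cases x)
  obtain y0 y1 y2 where y: "y = (y0, y1, y2)" by (cases y)
  obtain z0 z1 z2 where z: "z = (z0, z1, z2)" by (cases z)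
  obtain v0 v1 v2 where vv: "v = (v0, v1, v2)" by (cases v)
  define n0 n1 n2 where n: "n0 = x1 * y2 - x2 * y1" "n1 = x2 * y0 - x0 * y2" "n2 = x0 * y1 - x1 * y0"
  have vx: "v0 * x0 + v1 * x1 + v2 * x2 = 0" and vy: "v0 * y0 + v1 * y1 + v2 * y2 = 0"
    using v by (simp_all add: x y vv)
  have par: "v0 * n1 = v1 * n0" "v0 * n2 = v2 * n0" "v1 * n2 = v2 * n1"
    unfolding n using vx vy by algebra+
  have nz: "n0 \<noteq> 0 \<or> n1 \<noteq> 0 \<or> n2 \<noteq> 0" using xy by (auto simp: x y n)
  have vnz: "v0 \<noteq> 0 \<or> v1 \<noteq> 0 \<or> v2 \<noteq> 0" using v by (auto simp: vv)
  have d: "dot v z = v0 * z0 + v1 * z1 + v2 * z2" "det3 x y z = n0 * z0 + n1 * z1 + n2 * z2"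
    by (simp_all add: vv z x y n)
  have scale: "n0 * dot v z = v0 * det3 x y z" "n1 * dot v z = v1 * det3 x y z"
    "n2 * dot v z = v2 * det3 x y z"
    unfolding d using par by algebra+
  have "v0 \<noteq> 0 \<or> n0 = 0" "v1 \<noteq> 0 \<or> n1 = 0" "v2 \<noteq> 0 \<or> n2 = 0"
    using par vnz by auto
  then show ?thesis using scale nz by (metis mult_eq_0_iff)
qed

lemma coordinates_in_plane:
  fixes x0 x1 x2 y0 y1 y2 z0 z1 z2 :: int
  assumes xy: "cross x y \<noteq> (0, 0, 0)" and det: "det3 x y z = 0"
    and x: "x = (x0, x1, x2)" and y: "y = (y0, y1, y2)" and z: "z = (z0, z1, z2)"
  obtains a b :: real where "z0 = a * x0 + b * y0" "z1 = a * x1 + b * y1" "z2 = a * x2 + b * y2"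
proof -
  have eq: "(x1 * y2 - x2 * y1) * z0 + (x2 * y0 - x0 * y2) * z1 + (x0 * y1 - x1 * y0) * z2 = 0"
    using det by (simp add: x y z)
  from xy consider "x1 * y2 - x2 * y1 \<noteq> 0" | "x2 * y0 - x0 * y2 \<noteq> 0" | "x0 * y1 - x1 * y0 \<noteq> 0"
    by (auto simp: x y)
  then obtain D A B :: int where D: "D \<noteq> 0"
    "D * z0 = A * x0 + B * y0" "D * z1 = A * x1 + B * y1" "D * z2 = A * x2 + B * y2"
  proof cases
    case 1
    have "(x1 * y2 - x2 * y1) * z0 = (z1 * y2 - z2 * y1) * x0 + (x1 * z2 - x2 * z1) * y0"
      using eq by (simp add: algebra_simps)
    with 1 show ?thesis
      by (intro that[of "x1 * y2 - x2 * y1" "z1 * y2 - z2 * y1" "x1 * z2 - x2 * z1"])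
        (auto simp: algebra_simps)
  next
    case 2
    have "(x2 * y0 - x0 * y2) * z1 = (z2 * y0 - z0 * y2) * x1 + (x2 * z0 - x0 * z2) * y1"
      using eq by (simp add: algebra_simps)
    with 2 show ?thesis
      by (intro that[of "x2 * y0 - x0 * y2" "z2 * y0 - z0 * y2" "x2 * z0 - x0 * z2"])
        (auto simp: algebra_simps)
  next
    case 3
    have "(x0 * y1 - x1 * y0) * z2 = (z0 * y1 - z1 * y0) * x2 + (x0 * z1 - x1 * z0) * y2"
      using eq by (simp add: algebra_simps)
    with 3 show ?thesis
      by (intro that[of "x0 * y1 - x1 * y0" "z0 * y1 - z1 * y0" "x0 * z1 - x1 * z0"])
        (auto simp: algebra_simps)
  qed
  have "real_of_int w = (A / D) * u + (B / D) * v" if "D * w = A * u + B * v" for w u v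
  proof -
    have "real_of_int D * w = A * u + B * v" using that by (metis of_int_add of_int_mult)
    then show ?thesis using D(1) by (simp add: field_simps)
  qed
  then show thesis using that D by blast
qed

lemma cross_lin_comb:
  "cross (lin_comb a x b y) (lin_comb c x d y) = lin_comb (a * d - b * c) (cross x y) 0 (cross x y)"
  by (cases x; cases y; simp add: algebra_simps)

lemma max_norm_scale: "max_norm (lin_comb a x 0 y) = \<bar>a\<bar> * max_norm x"
  by (cases x; cases y; simp add: abs_mult max_mult_distrib_left)

lemma abs_err:
  "\<bar>x0 * \<xi> - x1\<bar> \<le> err \<xi> (x0, x1, x2)" "\<bar>x0 * \<xi>\<^sup>2 - x2\<bar> \<le> err \<xi> (x0, x1, x2)"
  by auto

text \<open>The estimates that follow all have one shape: an integer form in the coordinates is rewritten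
  in terms of \<open>x\<^sub>0\<close> and the errors \<open>e\<^sub>1 = x\<^sub>0 \<xi> - x\<^sub>1\<close>, \<open>e\<^sub>2 = x\<^sub>0 \<xi>\<^sup>2 - x\<^sub>2\<close>, where multiples of
  \<open>(1, \<xi>, \<xi>\<^sup>2)\<close> contribute nothing (for a scalar product, a multiple of the value at \<open>\<xi>\<close>), and the
  remaining monomials are bounded one by one.\<close>

lemma abs_mult_le: "\<bar>a\<bar> \<le> A \<Longrightarrow> \<bar>b\<bar> \<le> B \<Longrightarrow> \<bar>a * b\<bar> \<le> A * (B::real)"
  unfolding abs_mult by (intro mult_mono) auto

lemma abs_det2_le: "\<bar>det2 x\<bar> \<le> (1 + 2 * \<bar>\<xi>\<bar>) * size0 x * err \<xi> x + (err \<xi> x)\<^sup>2"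
proof -
  obtain x0 x1 x2 where x: "x = (x0, x1, x2)" by (cases x)
  define e1 e2 where e: "e1 = x0 * \<xi> - x1" "e2 = x0 * \<xi>\<^sup>2 - x2"
  have le: "\<bar>e1\<bar> \<le> err \<xi> x" "\<bar>e2\<bar> \<le> err \<xi> x" unfolding e x by (rule abs_err)+
  have "real_of_int (det2 x) = 2 * (\<xi> * (x0 * e1)) - x0 * e2 - e1 * e1"
    by (simp add: x e power2_eq_square algebra_simps)
  moreover have "\<bar>\<xi> * (x0 * e1)\<bar> \<le> \<bar>\<xi>\<bar> * (size0 x * err \<xi> x)" "\<bar>x0 * e2\<bar> \<le> size0 x * err \<xi> x"
    "\<bar>e1 * e1\<bar> \<le> err \<xi> x * err \<xi> x"
    by (intro abs_mult_le le; simp add: x)+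
  ultimately have "\<bar>real_of_int (det2 x)\<bar> \<le> 2 * (\<bar>\<xi>\<bar> * (size0 x * err \<xi> x)) + size0 x * err \<xi> x + err \<xi> x * err \<xi> x"
    by linarith
  then show ?thesis by (simp add: algebra_simps power2_eq_square)
qed

lemma abs_det3_le:
  "\<bar>det3 x y z\<bar> \<le> 2 * (size0 x * err \<xi> y * err \<xi> z + size0 y * err \<xi> x * err \<xi> z + size0 z * err \<xi> x * err \<xi> y)"
proof -
  obtain x0 x1 x2 where x: "x = (x0, x1, x2)" by (cases x)
  obtain y0 y1 y2 where y: "y = (y0, y1, y2)" by (cases y)
  obtain z0 z1 z2 where z: "z = (z0, z1, z2)" by (cases z)
  define e1 e2 f1 f2 g1 g2 where e: "e1 = x0 * \<xi> - x1" "e2 = x0 * \<xi>\<^sup>2 - x2"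
    "f1 = y0 * \<xi> - y1" "f2 = y0 * \<xi>\<^sup>2 - y2" "g1 = z0 * \<xi> - z1" "g2 = z0 * \<xi>\<^sup>2 - z2"
  have le: "\<bar>e1\<bar> \<le> err \<xi> x" "\<bar>e2\<bar> \<le> err \<xi> x" "\<bar>f1\<bar> \<le> err \<xi> y" "\<bar>f2\<bar> \<le> err \<xi> y"
    "\<bar>g1\<bar> \<le> err \<xi> z" "\<bar>g2\<bar> \<le> err \<xi> z"
    unfolding e x y z by (rule abs_err)+
  have 1: "\<bar>real_of_int x0\<bar> \<le> size0 x" "\<bar>real_of_int y0\<bar> \<le> size0 y" "\<bar>real_of_int z0\<bar> \<le> size0 z"
    by (simp_all add: x y z)
  have "real_of_int (det3 x y z) = x0 * f1 * g2 - x0 * f2 * g1 + (y0 * e2 * g1 - y0 * e1 * g2)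
      + (z0 * e1 * f2 - z0 * e2 * f1)"
    by (simp add: x y z e power2_eq_square algebra_simps)
  moreover have "\<bar>x0 * f1 * g2\<bar> \<le> size0 x * err \<xi> y * err \<xi> z" "\<bar>x0 * f2 * g1\<bar> \<le> size0 x * err \<xi> y * err \<xi> z"
    "\<bar>y0 * e2 * g1\<bar> \<le> size0 y * err \<xi> x * err \<xi> z" "\<bar>y0 * e1 * g2\<bar> \<le> size0 y * err \<xi> x * err \<xi> z"
    "\<bar>z0 * e1 * f2\<bar> \<le> size0 z * err \<xi> x * err \<xi> y" "\<bar>z0 * e2 * f1\<bar> \<le> size0 z * err \<xi> x * err \<xi> y"
    by (intro abs_mult_le le 1)+
  ultimately have "\<bar>real_of_int (det3 x y z)\<bar> \<le> 2 * (size0 x * err \<xi> y * err \<xi> z)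
     + 2 * (size0 y * err \<xi> x * err \<xi> z) + 2 * (size0 z * err \<xi> x * err \<xi> y)"
    by linarith
  then show ?thesis by simp
qed

lemma max_norm_cross_le:
  "max_norm (cross x y) \<le> (2 + \<bar>\<xi>\<bar> + \<xi>\<^sup>2) * (size0 x * err \<xi> y + size0 y * err \<xi> x + err \<xi> x * err \<xi> y)"
proof -
  obtain x0 x1 x2 where x: "x = (x0, x1, x2)" by (cases x)
  obtain y0 y1 y2 where y: "y = (y0, y1, y2)" by (cases y)
  define e1 e2 f1 f2 where e: "e1 = x0 * \<xi> - x1" "e2 = x0 * \<xi>\<^sup>2 - x2"
    "f1 = y0 * \<xi> - y1" "f2 = y0 * \<xi>\<^sup>2 - y2"
  have le: "\<bar>e1\<bar> \<le> err \<xi> x" "\<bar>e2\<bar> \<le> err \<xi> x" "\<bar>f1\<bar> \<le> err \<xi> y" "\<bar>f2\<bar> \<le> err \<xi> y"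
    unfolding e x y by (rule abs_err)+
  have 1: "\<bar>real_of_int x0\<bar> \<le> size0 x" "\<bar>real_of_int y0\<bar> \<le> size0 y"
    by (simp_all add: x y)
  let ?A = "size0 x * err \<xi> y" and ?B = "size0 y * err \<xi> x" and ?C = "err \<xi> x * err \<xi> y"
  have nonneg: "?A \<ge> 0" "?B \<ge> 0" "?C \<ge> 0" by (simp_all add: size0_nonneg err_nonneg)
  have m: "\<bar>x0 * f1\<bar> \<le> ?A" "\<bar>x0 * f2\<bar> \<le> ?A" "\<bar>y0 * e1\<bar> \<le> ?B" "\<bar>y0 * e2\<bar> \<le> ?B"
    "\<bar>e1 * f2\<bar> \<le> ?C" "\<bar>e2 * f1\<bar> \<le> ?C"
    by (intro abs_mult_le le 1)+
  have k: "\<bar>\<xi> * (y0 * e2 - x0 * f2)\<bar> \<le> \<bar>\<xi>\<bar> * (?A + ?B)" "\<bar>\<xi>\<^sup>2 * (x0 * f1 - y0 * e1)\<bar> \<le> \<xi>\<^sup>2 * (?A + ?B)"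
    by (rule abs_mult_le; use m in simp)+
  have sum4: "\<bar>p + q + (u - v)\<bar> \<le> P + Q + 2 * R" if "\<bar>p\<bar> \<le> P" "\<bar>q\<bar> \<le> Q" "\<bar>u\<bar> \<le> R" "\<bar>v\<bar> \<le> R"
    for p q u v P Q R :: real
    using that by linarith
  let ?S = "?A + ?B + ?C"
  have "\<bar>real_of_int (x1 * y2 - x2 * y1)\<bar> = \<bar>\<xi> * (y0 * e2 - x0 * f2) + \<xi>\<^sup>2 * (x0 * f1 - y0 * e1) + (e1 * f2 - e2 * f1)\<bar>"
    by (simp add: e power2_eq_square algebra_simps)
  also have "\<dots> \<le> \<bar>\<xi>\<bar> * (?A + ?B) + \<xi>\<^sup>2 * (?A + ?B) + 2 * ?C"
    by (rule sum4[OF k m(5,6)])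
  also have "\<dots> \<le> \<bar>\<xi>\<bar> * ?S + \<xi>\<^sup>2 * ?S + 2 * ?S"
    by (rule add_mono[OF add_mono[OF mult_left_mono mult_left_mono] mult_left_mono])
      (use nonneg in auto)
  also have "\<dots> = (2 + \<bar>\<xi>\<bar> + \<xi>\<^sup>2) * ?S" by (simp add: algebra_simps)
  finally have n0: "\<bar>real_of_int (x1 * y2 - x2 * y1)\<bar> \<le> (2 + \<bar>\<xi>\<bar> + \<xi>\<^sup>2) * ?S" .
  have "1 * ?S \<le> (2 + \<bar>\<xi>\<bar> + \<xi>\<^sup>2) * ?S" by (intro mult_right_mono) (use nonneg in auto)
  then have AB: "?A + ?B \<le> (2 + \<bar>\<xi>\<bar> + \<xi>\<^sup>2) * ?S" using nonneg(3) by (simp only: mult_1)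
  have "real_of_int (x2 * y0 - x0 * y2) = x0 * f2 - y0 * e2" "real_of_int (x0 * y1 - x1 * y0) = y0 * e1 - x0 * f1"
    by (simp_all add: e power2_eq_square algebra_simps)
  then have "\<bar>real_of_int (x2 * y0 - x0 * y2)\<bar> \<le> ?A + ?B" "\<bar>real_of_int (x0 * y1 - x1 * y0)\<bar> \<le> ?A + ?B"
    using m by linarith+
  with n0 AB have "max \<bar>real_of_int (x1 * y2 - x2 * y1)\<bar> (max \<bar>real_of_int (x2 * y0 - x0 * y2)\<bar>
      \<bar>real_of_int (x0 * y1 - x1 * y0)\<bar>) \<le> (2 + \<bar>\<xi>\<bar> + \<xi>\<^sup>2) * ?S"
    by (intro max.boundedI) (auto intro: order_trans)
  then show ?thesis by (simp only: x y cross.simps max_norm.simps)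
qed

lemma size0_err_le_cross: "size0 y * err \<xi> x \<le> size0 x * err \<xi> y + max_norm (cross x y)"
proof -
  obtain x0 x1 x2 where x: "x = (x0, x1, x2)" by (cases x)
  obtain y0 y1 y2 where y: "y = (y0, y1, y2)" by (cases y)
  define e1 e2 f1 f2 where e: "e1 = x0 * \<xi> - x1" "e2 = x0 * \<xi>\<^sup>2 - x2"
    "f1 = y0 * \<xi> - y1" "f2 = y0 * \<xi>\<^sup>2 - y2"
  have le: "\<bar>f1\<bar> \<le> err \<xi> y" "\<bar>f2\<bar> \<le> err \<xi> y"
    unfolding e y by (rule abs_err)+
  have 1: "\<bar>real_of_int x0\<bar> \<le> size0 x" by (simp_all add: x)
  have n: "\<bar>real_of_int (x2 * y0 - x0 * y2)\<bar> \<le> max_norm (cross x y)"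
    "\<bar>real_of_int (x0 * y1 - x1 * y0)\<bar> \<le> max_norm (cross x y)"
    unfolding x y cross.simps by (rule abs_coord_le_max_norm)+
  have "\<bar>x0 * f1\<bar> \<le> size0 x * err \<xi> y" "\<bar>x0 * f2\<bar> \<le> size0 x * err \<xi> y"
    by (intro abs_mult_le le 1)+
  moreover have "y0 * e2 = x0 * f2 - real_of_int (x2 * y0 - x0 * y2)"
    "y0 * e1 = x0 * f1 + real_of_int (x0 * y1 - x1 * y0)"
    by (simp_all add: e power2_eq_square algebra_simps)
  ultimately have "\<bar>y0 * e1\<bar> \<le> size0 x * err \<xi> y + max_norm (cross x y)"
    "\<bar>y0 * e2\<bar> \<le> size0 x * err \<xi> y + max_norm (cross x y)"
    using n by linarith+
  then have "max (\<bar>y0\<bar> * \<bar>e1\<bar>) (\<bar>y0\<bar> * \<bar>e2\<bar>) \<le> size0 x * err \<xi> y + max_norm (cross x y)"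
    by (simp add: abs_mult)
  then show ?thesis by (simp add: x y e max_mult_distrib_left)
qed

lemma eval_at_approx:
  shows size0_eval_le: "size0 x * \<bar>eval_at \<xi> p\<bar> \<le> \<bar>dot p x\<bar> + 2 * max_norm p * err \<xi> x"
    and abs_dot_le: "\<bar>dot p x\<bar> \<le> size0 x * \<bar>eval_at \<xi> p\<bar> + 2 * max_norm p * err \<xi> x"
proof -
  obtain x0 x1 x2 where x: "x = (x0, x1, x2)" by (cases x)
  obtain p0 p1 p2 where p: "p = (p0, p1, p2)" by (cases p)
  define e1 e2 where e: "e1 = x0 * \<xi> - x1" "e2 = x0 * \<xi>\<^sup>2 - x2"
  have le: "\<bar>e1\<bar> \<le> err \<xi> x" "\<bar>e2\<bar> \<le> err \<xi> x" unfolding e x by (rule abs_err)+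
  have P: "\<bar>real_of_int p1\<bar> \<le> max_norm p" "\<bar>real_of_int p2\<bar> \<le> max_norm p" by (auto simp: p)
  have "real_of_int (dot p x) = x0 * eval_at \<xi> p - p1 * e1 - p2 * e2"
    by (simp add: x p e algebra_simps)
  moreover have "\<bar>p1 * e1\<bar> \<le> max_norm p * err \<xi> x" "\<bar>p2 * e2\<bar> \<le> max_norm p * err \<xi> x"
    by (intro abs_mult_le le P)+
  moreover have "\<bar>x0 * eval_at \<xi> p\<bar> = size0 x * \<bar>eval_at \<xi> p\<bar>" by (simp add: x abs_mult)
  ultimately show "size0 x * \<bar>eval_at \<xi> p\<bar> \<le> \<bar>dot p x\<bar> + 2 * max_norm p * err \<xi> x"
    and "\<bar>dot p x\<bar> \<le> size0 x * \<bar>eval_at \<xi> p\<bar> + 2 * max_norm p * err \<xi> x" by linarith+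
qed

text \<open>A point with \<open>x\<^sub>0 x\<^sub>2 = x\<^sub>1\<^sup>2\<close> has the form \<open>t (m\<^sup>2, m n, n\<^sup>2)\<close>. The two integers \<open>m y\<^sub>1 - n y\<^sub>0\<close> and
  \<open>m y\<^sub>2 - n y\<^sub>1\<close> vanish together only if \<open>y\<close> is parallel to that point. Multiplied by \<open>t m\<close>, of absolute value
  at least the square root of \<open>|t| m\<^sup>2\<close>, each is a form that is small at two good approximations.\<close>

lemma degenerate_point_size_le:
  assumes a: "det2 a = 0" "size0 a > 0" and indep: "cross a y \<noteq> (0, 0, 0)"
  shows "sqrt (size0 a) \<le> (1 + \<bar>\<xi>\<bar>) * (size0 a * err \<xi> y + size0 y * err \<xi> a) + err \<xi> a * err \<xi> y"
proof -
  obtain a0 a1 a2 where aa: "a = (a0, a1, a2)" by (cases a)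
  obtain y0 y1 y2 where y: "y = (y0, y1, y2)" by (cases y)
  have a0: "a0 \<noteq> 0" and deg: "a0 * a2 = a1 * a1" using a by (auto simp: aa power2_eq_square)
  define d where "d = gcd a0 a1"
  have d: "d \<noteq> 0" using a0 by (simp add: d_def)
  obtain m n where mn: "a0 = m * d" "a1 = n * d" "coprime m n"
    using gcd_coprime_exists[of a0 a1] d unfolding d_def by blast
  have m: "m \<noteq> 0" using a0 mn by auto
  have "m * a2 = d * n * n" using deg d unfolding mn by (simp add: algebra_simps)
  then have "m dvd (d * n) * n" by (metis dvd_triv_left)
  then have "m dvd d" using mn(3) coprime_dvd_mult_left_iff by blast
  then obtain t where t: "d = m * t" by (rule dvdE)
  have t0: "t \<noteq> 0" using d t by auto
  have a2: "a2 = t * n * n" using \<open>m * a2 = d * n * n\<close> m unfolding t by simp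
  \<comment> \<open>The two integral relations; \<open>y\<close> being independent of \<open>a\<close>, one of them is nonzero.\<close>
  define k1 k2 where k: "k1 = m * y1 - n * y0" "k2 = m * y2 - n * y1"
  have nz: "k1 \<noteq> 0 \<or> k2 \<noteq> 0"
  proof (rule ccontr)
    assume "\<not> (k1 \<noteq> 0 \<or> k2 \<noteq> 0)"
    then have e: "m * y1 = n * y0" "m * y2 = n * y1" by (simp_all add: k)
    have "n * (m * y2) = n * (n * y1)" "m * (m * y2) = n * (m * y1)" "n * (m * y1) = n * (n * y0)"
      using e by simp_all
    then have "n * m * y2 - n * n * y1 = 0" "n * n * y0 - m * m * y2 = 0" "m * y1 - n * y0 = 0"
      using e by (simp_all add: algebra_simps)
    moreover have "cross a y = (t * (n * m * y2 - n * n * y1), t * (n * n * y0 - m * m * y2), t * m * (m * y1 - n * y0))"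
      by (simp add: aa y mn(1,2) t a2 algebra_simps)
    ultimately have "cross a y = (0, 0, 0)" by simp
    with indep show False by simp
  qed
  define e1 e2 f1 f2 where e: "e1 = a0 * \<xi> - a1" "e2 = a0 * \<xi>\<^sup>2 - a2"
    "f1 = y0 * \<xi> - y1" "f2 = y0 * \<xi>\<^sup>2 - y2"
  have le: "\<bar>e1\<bar> \<le> err \<xi> a" "\<bar>e2\<bar> \<le> err \<xi> a" "\<bar>f1\<bar> \<le> err \<xi> y" "\<bar>f2\<bar> \<le> err \<xi> y"
    unfolding e aa y by (rule abs_err)+
  have 1: "\<bar>real_of_int a0\<bar> \<le> size0 a" "\<bar>real_of_int y0\<bar> \<le> size0 y"
    by (simp_all add: aa y)
  let ?A = "size0 a * err \<xi> y" and ?B = "size0 y * err \<xi> a" and ?C = "err \<xi> a * err \<xi> y"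
  have nonneg: "?A \<ge> 0" "?B \<ge> 0" "?C \<ge> 0" by (simp_all add: size0_nonneg err_nonneg)
  have b: "\<bar>a0 * f1\<bar> \<le> ?A" "\<bar>a0 * f2\<bar> \<le> ?A" "\<bar>y0 * e1\<bar> \<le> ?B" "\<bar>e1 * f1\<bar> \<le> ?C"
    by (intro abs_mult_le le 1)+
  have "\<bar>a0 * f1 + y0 * e1\<bar> \<le> ?A + ?B" using b(1,3) by linarith
  then have \<xi>b: "\<bar>\<xi> * (a0 * f1 + y0 * e1)\<bar> \<le> \<bar>\<xi>\<bar> * (?A + ?B)" by (intro abs_mult_le) auto
  have "real_of_int (m * t * k1) = y0 * e1 - a0 * f1"
    by (simp add: k e mn t algebra_simps)
  then have k1: "\<bar>real_of_int (m * t * k1)\<bar> \<le> ?A + ?B" using b(1,3) by linarith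
  have "real_of_int (m * t * k2) = \<xi> * (a0 * f1 + y0 * e1) - a0 * f2 - e1 * f1"
    by (simp add: k e mn t power2_eq_square algebra_simps)
  then have k2: "\<bar>real_of_int (m * t * k2)\<bar> \<le> \<bar>\<xi>\<bar> * (?A + ?B) + ?A + ?C"
    using b(2,4) \<xi>b by linarith
  have "\<bar>m * t\<bar> * 1 \<le> \<bar>m * t * k1\<bar> \<or> \<bar>m * t\<bar> * 1 \<le> \<bar>m * t * k2\<bar>"
    using nz unfolding abs_mult[of "m * t"] by (metis abs_ge_zero mult_left_mono int_one_le_iff_zero_less zero_less_abs_iff)
  then have "real_of_int \<bar>m * t\<bar> \<le> \<bar>real_of_int (m * t * k1)\<bar> \<or> real_of_int \<bar>m * t\<bar> \<le> \<bar>real_of_int (m * t * k2)\<bar>"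
    by (metis mult.right_neutral of_int_abs of_int_le_iff)
  moreover have "0 \<le> \<bar>\<xi>\<bar> * (?A + ?B)" using nonneg by simp
  ultimately have mt: "real_of_int \<bar>m * t\<bar> \<le> (?A + ?B) + \<bar>\<xi>\<bar> * (?A + ?B) + ?C"
    using k1 k2 nonneg by argo
  have "\<bar>a0\<bar> * 1 \<le> \<bar>a0\<bar> * \<bar>t\<bar>" using t0 by (intro mult_left_mono) auto
  also have "\<dots> = (m * t)\<^sup>2" by (simp add: mn t abs_mult power2_eq_square mult_ac)
  finally have "real_of_int \<bar>a0\<bar> \<le> (real_of_int \<bar>m * t\<bar>)\<^sup>2"
    by (metis mult.right_neutral of_int_le_iff of_int_power power2_abs)
  then have "sqrt (size0 a) \<le> real_of_int \<bar>m * t\<bar>" by (intro real_le_lsqrt) (auto simp: aa)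
  with mt have "sqrt (size0 a) \<le> (?A + ?B) + \<bar>\<xi>\<bar> * (?A + ?B) + ?C" by (rule order_trans[rotated])
  then show ?thesis by (simp only: distrib_right mult_1)
qed

text \<open>Reducing the coordinates of \<open>z\<close> with respect to \<open>x\<close>, \<open>y\<close> modulo 1 to absolute value at most \<open>1/2\<close>
  yields an integer point smaller than \<open>y\<close> and with error less than that of \<open>x\<close>; by minimality it is zero.\<close>

lemma lattice_basis_of_minimal:
  assumes xy: "cross x y \<noteq> (0, 0, 0)" and size: "size0 x < size0 y" and err: "err \<xi> y < err \<xi> x"
    and min: "\<And>z. z \<noteq> (0, 0, 0) \<Longrightarrow> size0 z < size0 y \<Longrightarrow> err \<xi> x \<le> err \<xi> z"
    and z: "det3 x y z = 0"
  obtains a b where "z = lin_comb a x b y"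
proof -
  obtain x0 x1 x2 where x: "x = (x0, x1, x2)" by (cases x)
  obtain y0 y1 y2 where y: "y = (y0, y1, y2)" by (cases y)
  obtain z0 z1 z2 where zz: "z = (z0, z1, z2)" by (cases z)
  obtain a b :: real where ab: "z0 = a * x0 + b * y0" "z1 = a * x1 + b * y1" "z2 = a * x2 + b * y2"
    using coordinates_in_plane[OF xy z x y zz] .
  define r s where rs: "r = a - round a" "s = b - round b"
  have half: "\<bar>r\<bar> \<le> 1/2" "\<bar>s\<bar> \<le> 1/2"
    using of_int_round_abs_le[of a] of_int_round_abs_le[of b] by (simp_all add: rs abs_minus_commute)
  define w where "w = (z0 - round a * x0 - round b * y0, z1 - round a * x1 - round b * y1, z2 - round a * x2 - round b * y2)"
  define w0 w1 w2 where w012: "w0 = z0 - round a * x0 - round b * y0" "w1 = z1 - round a * x1 - round b * y1" "w2 = z2 - round a * x2 - round b * y2"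
  have w: "w = (w0, w1, w2)" by (simp add: w_def w012)
  have wr: "real_of_int w0 = r * x0 + s * y0" "real_of_int w1 = r * x1 + s * y1" "real_of_int w2 = r * x2 + s * y2"
    unfolding w012 of_int_diff of_int_mult ab by (simp_all add: rs algebra_simps)
  have comb: "\<bar>r * u + s * v\<bar> \<le> (U + V) / 2" if "\<bar>u\<bar> \<le> U" "\<bar>v\<bar> \<le> V" for u v U V :: real
    using abs_mult_le[OF half(1) that(1)] abs_mult_le[OF half(2) that(2)]
      abs_triangle_ineq[of "r * u" "s * v"] by (simp add: field_simps)
  have "size0 w \<le> (size0 x + size0 y) / 2"
    unfolding w size0.simps wr by (rule comb) (simp_all add: x y)
  then have "size0 w < size0 y" using size by (simp add: field_simps)
  moreover have "w0 * \<xi> - w1 = r * (x0 * \<xi> - x1) + s * (y0 * \<xi> - y1)" "w0 * \<xi>\<^sup>2 - w2 = r * (x0 * \<xi>\<^sup>2 - x2) + s * (y0 * \<xi>\<^sup>2 - y2)"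
    unfolding wr by (simp_all add: algebra_simps)
  then have "err \<xi> w \<le> (err \<xi> x + err \<xi> y) / 2"
    unfolding w err.simps by (metis (no_types) abs_err comb max.bounded_iff x y)
  then have "err \<xi> w < err \<xi> x" using err by (simp add: field_simps)
  ultimately have "w = (0, 0, 0)" using min[of w] by linarith
  then have "z = lin_comb (round a) x (round b) y" by (simp add: w_def x y zz)
  then show thesis by (rule that)
qed

lemma eval_at_cross_le: "\<bar>eval_at \<xi> (cross y z)\<bar> \<le> 2 * err \<xi> y * err \<xi> z"
proof -
  obtain y0 y1 y2 where y: "y = (y0, y1, y2)" by (cases y)
  obtain z0 z1 z2 where z: "z = (z0, z1, z2)" by (cases z)
  define e1 e2 f1 f2 where e: "e1 = y0 * \<xi> - y1" "e2 = y0 * \<xi>\<^sup>2 - y2"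
    "f1 = z0 * \<xi> - z1" "f2 = z0 * \<xi>\<^sup>2 - z2"
  have le: "\<bar>e1\<bar> \<le> err \<xi> y" "\<bar>e2\<bar> \<le> err \<xi> y" "\<bar>f1\<bar> \<le> err \<xi> z" "\<bar>f2\<bar> \<le> err \<xi> z"
    unfolding e y z by (rule abs_err)+
  have "eval_at \<xi> (cross y z) = e1 * f2 - e2 * f1"
    by (simp add: y z e power2_eq_square algebra_simps)
  moreover have "\<bar>e1 * f2\<bar> \<le> err \<xi> y * err \<xi> z" "\<bar>e2 * f1\<bar> \<le> err \<xi> y * err \<xi> z"
    by (intro abs_mult_le le)+
  ultimately show ?thesis by linarith
qed

text \<open>The derivative at \<open>\<xi>\<close> of the polynomial with coefficients \<open>y \<times> z\<close> is governed by
  \<open>e\<^sub>2 - 2 \<xi> e\<^sub>1\<close>, where \<open>e\<^sub>1\<close>, \<open>e\<^sub>2\<close> are the errors of \<open>y\<close>, and \<open>y\<^sub>0 (e\<^sub>2 - 2 \<xi> e\<^sub>1)\<close> equals minus the determinant of \<open>y\<close>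
  up to \<open>e\<^sub>1\<^sup>2\<close>. A nonzero determinant thus keeps the derivative of order \<open>size0 z / size0 y\<close>.\<close>

lemma deriv_cross_ge:
  assumes q: "cross y z = (q0, q1, q2)" and det: "det2 y \<noteq> 0" and err: "err \<xi> y \<le> 1 / 2"
  shows "3 * size0 z \<le> 4 * size0 y * \<bar>q1 + 2 * \<xi> * q2\<bar> + 4 * (1 + 2 * \<bar>\<xi>\<bar>) * (size0 y)\<^sup>2 * err \<xi> z"
proof -
  obtain y0 y1 y2 where y: "y = (y0, y1, y2)" by (cases y)
  obtain z0 z1 z2 where z: "z = (z0, z1, z2)" by (cases z)
  define e1 e2 f1 f2 where e: "e1 = y0 * \<xi> - y1" "e2 = y0 * \<xi>\<^sup>2 - y2"
    "f1 = z0 * \<xi> - z1" "f2 = z0 * \<xi>\<^sup>2 - z2"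
  have "\<bar>e1\<bar> \<le> err \<xi> y" unfolding e y by (rule abs_err)
  then have e1: "\<bar>e1\<bar> \<le> 1 / 2" using err by (rule order_trans)
  have le: "\<bar>f1\<bar> \<le> err \<xi> z" "\<bar>f2\<bar> \<le> err \<xi> z" unfolding e z by (rule abs_err)+
  have q12: "q1 = y2 * z0 - y0 * z2" "q2 = y0 * z1 - y1 * z0" using q by (simp_all add: y z)
  have "y0 * (q1 + 2 * \<xi> * q2) = y0\<^sup>2 * (f2 - 2 * (\<xi> * f1)) + z0 * (real_of_int (det2 y) + e1 * e1)"
    by (simp add: q12 y e power2_eq_square algebra_simps)
  then have "z0 * (real_of_int (det2 y) + e1 * e1) = y0 * (q1 + 2 * \<xi> * q2) - y0\<^sup>2 * (f2 - 2 * (\<xi> * f1))" by simp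
  then have "\<bar>z0 * (real_of_int (det2 y) + e1 * e1)\<bar> \<le> \<bar>y0 * (q1 + 2 * \<xi> * q2)\<bar> + \<bar>y0\<^sup>2 * (f2 - 2 * (\<xi> * f1))\<bar>"
    by linarith
  moreover have "\<bar>z0 * (real_of_int (det2 y) + e1 * e1)\<bar> \<ge> size0 z * (3 / 4)"
  proof -
    have "\<bar>e1 * e1\<bar> \<le> (1 / 2) * (1 / 2)" by (intro abs_mult_le e1)
    moreover have "1 \<le> \<bar>real_of_int (det2 y)\<bar>" using det by linarith
    moreover have "\<bar>real_of_int (det2 y)\<bar> \<le> \<bar>real_of_int (det2 y) + e1 * e1\<bar> + \<bar>e1 * e1\<bar>" by linarith
    ultimately have "3 / 4 \<le> \<bar>real_of_int (det2 y) + e1 * e1\<bar>" by simp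
    then show ?thesis unfolding abs_mult by (intro mult_mono) (auto simp: z)
  qed
  moreover have "\<bar>y0\<^sup>2 * (f2 - 2 * (\<xi> * f1))\<bar> \<le> (size0 y)\<^sup>2 * ((1 + 2 * \<bar>\<xi>\<bar>) * err \<xi> z)"
  proof (rule abs_mult_le)
    have "\<bar>\<xi> * f1\<bar> \<le> \<bar>\<xi>\<bar> * err \<xi> z" by (intro abs_mult_le le) simp
    then show "\<bar>f2 - 2 * (\<xi> * f1)\<bar> \<le> (1 + 2 * \<bar>\<xi>\<bar>) * err \<xi> z"
      using le(2) unfolding distrib_right by linarith
  qed (simp add: y)
  moreover have "\<bar>y0 * (q1 + 2 * \<xi> * q2)\<bar> = size0 y * \<bar>q1 + 2 * \<xi> * q2\<bar>" by (simp add: y abs_mult)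
  ultimately have "size0 z * (3 / 4) \<le> size0 y * \<bar>q1 + 2 * \<xi> * q2\<bar> + (size0 y)\<^sup>2 * ((1 + 2 * \<bar>\<xi>\<bar>) * err \<xi> z)"
    by linarith
  then show ?thesis by (simp add: algebra_simps)
qed

section \<open>The sequence of minimal points\<close>

lemma extremal_not_quadratic:
  assumes "extremal \<xi>" "eval_at \<xi> p = 0"
  shows "p = (0, 0, 0)"
proof (rule ccontr)
  assume nz: "p \<noteq> (0, 0, 0)"
  obtain p0 p1 p2 where p: "p = (p0, p1, p2)" by (cases p)
  have "[:p0, p1, p2:] \<noteq> 0" using nz p by auto
  moreover have "poly (map_poly of_int [:p0, p1, p2:]) \<xi> = 0"
    using assms(2) by (simp add: p map_poly_pCons power2_eq_square algebra_simps)
  ultimately have "algebraic \<xi> \<and> alg_degree \<xi> \<le> degree [:p0, p1, p2:]" by (rule alg_degree_le)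
  moreover have "degree [:p0, p1, p2:] \<le> 2" by simp
  ultimately show False using assms(1) unfolding extremal_def by linarith
qed

lemma err_pos:
  assumes "\<And>p. eval_at \<xi> p = 0 \<Longrightarrow> p = (0, 0, 0)" "x \<noteq> (0, 0, 0)"
  shows "err \<xi> x > 0"
proof (rule ccontr)
  assume "\<not> err \<xi> x > 0"
  obtain x0 x1 x2 where x: "x = (x0, x1, x2)" by (cases x)
  have e: "x0 * \<xi> = x1" "x0 * \<xi>\<^sup>2 = x2" using \<open>\<not> err \<xi> x > 0\<close> by (auto simp: x not_less)
  then have "(- x1, x0, 0) = (0::int, 0::int, 0::int)" by (intro assms(1)) simp
  with e assms(2) show False by (simp add: x)
qed

lemma finite_points_bounded: "finite {z. size0 z \<le> N \<and> err \<xi> z \<le> E}"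
proof -
  define b where "b = \<lceil>\<bar>N\<bar> * (1 + \<bar>\<xi>\<bar> + \<xi>\<^sup>2) + E\<rceil>"
  have "{z. size0 z \<le> N \<and> err \<xi> z \<le> E} \<subseteq> {-b..b} \<times> {-b..b} \<times> {-b..b}"
  proof safe
    fix z0 z1 z2 assume z: "size0 (z0, z1, z2) \<le> N" "err \<xi> (z0, z1, z2) \<le> E"
    have B: "\<bar>N\<bar> * (1 + \<bar>\<xi>\<bar> + \<xi>\<^sup>2) + E \<le> b" by (simp add: b_def)
    have E: "E \<ge> 0" using z(2) err_nonneg order_trans by blast
    have N: "\<bar>real_of_int z0\<bar> \<le> \<bar>N\<bar>" using z(1) by simp
    have m: "\<bar>z0 * \<xi>\<bar> \<le> \<bar>N\<bar> * \<bar>\<xi>\<bar>" "\<bar>z0 * \<xi>\<^sup>2\<bar> \<le> \<bar>N\<bar> * \<xi>\<^sup>2"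
      by (rule abs_mult_le[OF N]; simp)+
    have nn: "\<bar>N\<bar> * \<bar>\<xi>\<bar> \<ge> 0" "\<bar>N\<bar> * \<xi>\<^sup>2 \<ge> 0" by auto
    have B': "\<bar>N\<bar> + \<bar>N\<bar> * \<bar>\<xi>\<bar> + \<bar>N\<bar> * \<xi>\<^sup>2 + E \<le> b" using B by (simp add: algebra_simps)
    have e: "\<bar>z0 * \<xi> - z1\<bar> \<le> E" "\<bar>z0 * \<xi>\<^sup>2 - z2\<bar> \<le> E" using z(2) by auto
    have "\<bar>real_of_int z0\<bar> \<le> b" using N nn B' E by linarith
    then show "z0 \<in> {-b..b}" by auto
    have "\<bar>real_of_int z1\<bar> \<le> b" using e(1) m(1) nn B' abs_ge_zero[of N] by linarith
    then show "z1 \<in> {-b..b}" by auto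
    have "\<bar>real_of_int z2\<bar> \<le> b" using e(2) m(2) nn B' abs_ge_zero[of N] by linarith
    then show "z2 \<in> {-b..b}" by auto
  qed
  then show ?thesis by (rule finite_subset) auto
qed

text \<open>Minimality is required among points of the same size too, so that the successor of a minimal
  point is strictly larger, not only better.\<close>

definition minimal_point :: "real \<Rightarrow> point \<Rightarrow> bool" where
  "minimal_point \<xi> x \<longleftrightarrow>
    x \<noteq> (0, 0, 0) \<and> (\<forall>z. z \<noteq> (0, 0, 0) \<and> size0 z \<le> size0 x \<longrightarrow> err \<xi> x \<le> err \<xi> z)"

lemma least_err_exists:
  assumes "z \<noteq> (0, 0, 0)" "size0 z \<le> N"
  obtains y where "y \<noteq> (0, 0, 0)" "size0 y \<le> N"
    "\<And>w. w \<noteq> (0, 0, 0) \<Longrightarrow> size0 w \<le> N \<Longrightarrow> err \<xi> y \<le> err \<xi> w"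
proof -
  define S where "S = {w. w \<noteq> (0, 0, 0) \<and> size0 w \<le> N \<and> err \<xi> w \<le> err \<xi> z}"
  have "finite S" by (rule finite_subset[OF _ finite_points_bounded[of N \<xi> "err \<xi> z"]]) (auto simp: S_def)
  moreover have "z \<in> S" using assms by (simp add: S_def)
  ultimately obtain y where y: "y \<in> S" "\<And>w. w \<in> S \<Longrightarrow> err \<xi> y \<le> err \<xi> w"
    using ex_is_arg_min_if_finite[of S "err \<xi>"] unfolding is_arg_min_linorder by blast
  show thesis
  proof (rule that[of y])
    show "y \<noteq> (0, 0, 0)" "size0 y \<le> N" using y(1) by (auto simp: S_def)
    fix w assume w: "w \<noteq> (0, 0, 0)" "size0 w \<le> N"
    show "err \<xi> y \<le> err \<xi> w"
    proof (cases "err \<xi> w \<le> err \<xi> z")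
      case True
      then show ?thesis using w y(2) by (simp add: S_def)
    next
      case False
      then show ?thesis using y(1) by (simp add: S_def)
    qed
  qed
qed

text \<open>Among the points with smaller error take those of least size, and among these one of least error.\<close>

lemma next_minimal_point:
  assumes x: "minimal_point \<xi> x" and z: "z \<noteq> (0, 0, 0)" "err \<xi> z < err \<xi> x"
  obtains y where "minimal_point \<xi> y" "size0 x < size0 y" "err \<xi> y < err \<xi> x"
    "\<And>w. w \<noteq> (0, 0, 0) \<Longrightarrow> size0 w < size0 y \<Longrightarrow> err \<xi> x \<le> err \<xi> w"
proof -
  obtain u where u: "u \<noteq> (0, 0, 0)" "err \<xi> u < err \<xi> x"
    and least: "\<And>w. w \<noteq> (0, 0, 0) \<Longrightarrow> err \<xi> w < err \<xi> x \<Longrightarrow> size0 u \<le> size0 w"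
    using ex_has_least_nat[of "\<lambda>w. w \<noteq> (0, 0, 0) \<and> err \<xi> w < err \<xi> x" z "\<lambda>w. nat \<bar>fst w\<bar>"] z
    unfolding size0_eq_nat of_nat_le_iff by blast
  obtain y where y: "y \<noteq> (0, 0, 0)" "size0 y \<le> size0 u"
    and ymin: "\<And>w. w \<noteq> (0, 0, 0) \<Longrightarrow> size0 w \<le> size0 u \<Longrightarrow> err \<xi> y \<le> err \<xi> w"
    using least_err_exists[OF u(1) order_refl] by blast
  have "err \<xi> y \<le> err \<xi> u" using ymin[OF u(1)] by simp
  then have yx: "err \<xi> y < err \<xi> x" using u(2) by linarith
  have eq: "size0 y = size0 u" using least[OF y(1) yx] y(2) by linarith
  show thesis
  proof (rule that[of y])
    show "minimal_point \<xi> y" using y ymin eq by (auto simp: minimal_point_def)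
    show "size0 x < size0 y" using x y(1) yx unfolding minimal_point_def by (meson linorder_not_le)
    show "err \<xi> y < err \<xi> x" by (fact yx)
    show "err \<xi> x \<le> err \<xi> w" if "w \<noteq> (0, 0, 0)" "size0 w < size0 y" for w
      using least[OF that(1)] that(2) eq by linarith
  qed
qed

locale minimal_sequence =
  fixes \<xi> c :: real and x :: "nat \<Rightarrow> point"
  assumes not_quadratic: "eval_at \<xi> p = 0 \<Longrightarrow> p = (0, 0, 0)"
    and size_ge_1: "size0 (x i) \<ge> 1"
    and size_Suc: "size0 (x i) < size0 (x (Suc i))"
    and err_Suc: "err \<xi> (x (Suc i)) < err \<xi> (x i)"
    and err_le: "err \<xi> (x i) \<le> c * size0 (x (Suc i)) powr (1 - \<gamma>)"
    and err_min: "z \<noteq> (0, 0, 0) \<Longrightarrow> size0 z < size0 (x (Suc i)) \<Longrightarrow> err \<xi> (x i) \<le> err \<xi> z"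

text \<open>Extremality bounds the error of \<open>x i\<close> when it is applied with a parameter just below the size of
  \<open>x (Suc i)\<close>; half of that size is small enough and costs at most a factor 2.\<close>

lemma extremal_minimal_sequence:
  assumes "extremal \<xi>"
  obtains c x where "minimal_sequence \<xi> c x"
proof -
  note irr = extremal_not_quadratic[OF assms]
  have exponent: "- 1 / \<gamma> = 1 - \<gamma>" using inverse_golden_ratio by simp
  obtain c where c: "c > 0" and D: "\<And>X. X \<ge> 1 \<Longrightarrow>
    \<exists>z. z \<noteq> (0, 0, 0) \<and> size0 z \<le> X \<and> err \<xi> z \<le> c * X powr (1 - \<gamma>)"
  proof -
    from assms obtain c where c: "c > 0" and *: "\<forall>X\<ge>1. \<exists>x0 x1 x2 :: int. (x0, x1, x2) \<noteq> (0, 0, 0) \<and>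
      \<bar>real_of_int x0\<bar> \<le> X \<and> \<bar>of_int x0 * \<xi> - of_int x1\<bar> \<le> c * X powr (1 - \<gamma>) \<and>
      \<bar>of_int x0 * \<xi>\<^sup>2 - of_int x2\<bar> \<le> c * X powr (1 - \<gamma>)"
      unfolding extremal_def exponent by blast
    show thesis
    proof (rule that[OF c])
      fix X :: real assume "X \<ge> 1"
      with * obtain x0 x1 x2 :: int where "(x0, x1, x2) \<noteq> (0, 0, 0)" "\<bar>real_of_int x0\<bar> \<le> X"
        "\<bar>of_int x0 * \<xi> - of_int x1\<bar> \<le> c * X powr (1 - \<gamma>)"
        "\<bar>of_int x0 * \<xi>\<^sup>2 - of_int x2\<bar> \<le> c * X powr (1 - \<gamma>)" by blast
      then show "\<exists>z. z \<noteq> (0, 0, 0) \<and> size0 z \<le> X \<and> err \<xi> z \<le> c * X powr (1 - \<gamma>)"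
        by (intro exI[of _ "(x0, x1, x2)"]) simp
    qed
  qed
  \<comment> \<open>The parameter makes \<open>c X powr (1 - \<gamma>)\<close> at most \<open>E / 2\<close>.\<close>
  have small: "\<exists>z. z \<noteq> (0, 0, 0) \<and> err \<xi> z < E" if E: "E > 0" for E
  proof -
    define X where "X = max 1 ((2 * c / E) powr \<gamma>)"
    have "(2 * c / E) powr \<gamma> \<le> X" by (simp add: X_def)
    have X1: "X \<ge> 1" by (simp add: X_def)
    have "((2 * c / E) powr \<gamma>) powr (\<gamma> - 1) \<le> X powr (\<gamma> - 1)"
      using golden_ratio_gt_1 by (intro powr_mono2) (auto simp: X_def)
    moreover have "\<gamma> * (\<gamma> - 1) = 1"
      using golden_ratio_square by (simp add: algebra_simps power2_eq_square)
    ultimately have "2 * c / E \<le> X powr (\<gamma> - 1)" using c E by (simp add: powr_powr)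
    then have "2 * c \<le> X powr (\<gamma> - 1) * E" using E by (simp add: field_simps)
    then have "X powr (1 - \<gamma>) * (2 * c) \<le> X powr (1 - \<gamma>) * (X powr (\<gamma> - 1) * E)"
      by (intro mult_left_mono) auto
    also have "\<dots> = (X powr (1 - \<gamma>) * X powr (\<gamma> - 1)) * E" by (simp only: mult.assoc)
    also have "X powr (1 - \<gamma>) * X powr (\<gamma> - 1) = 1" using X1 by (simp flip: powr_add)
    finally have "2 * (c * X powr (1 - \<gamma>)) \<le> E" by (simp add: mult_ac)
    then have "c * X powr (1 - \<gamma>) < E" using E by linarith
    then show ?thesis using D[OF X1] by (meson le_less_trans)
  qed
  obtain z where z: "z \<noteq> (0, 0, 0)" "size0 z \<le> 1" using D[OF order_refl] by blast
  obtain m where m: "m \<noteq> (0, 0, 0)" "size0 m \<le> 1"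
    "\<And>w. w \<noteq> (0, 0, 0) \<Longrightarrow> size0 w \<le> 1 \<Longrightarrow> err \<xi> m \<le> err \<xi> w"
    using least_err_exists[OF z] by blast
  then have "minimal_point \<xi> m" unfolding minimal_point_def by (meson order_trans)
  have step: "\<exists>y. (minimal_point \<xi> y \<and> size0 y \<ge> 1) \<and> size0 x < size0 y \<and> err \<xi> y < err \<xi> x \<and>
      (\<forall>w. w \<noteq> (0, 0, 0) \<and> size0 w < size0 y \<longrightarrow> err \<xi> x \<le> err \<xi> w)" if x: "minimal_point \<xi> x" for x
  proof -
    have "err \<xi> x > 0" using x err_pos[OF irr] by (simp add: minimal_point_def)
    then obtain z where "z \<noteq> (0, 0, 0)" "err \<xi> z < err \<xi> x" using small by blast
    then obtain y where y: "minimal_point \<xi> y" "size0 x < size0 y" "err \<xi> y < err \<xi> x"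
      "\<And>w. w \<noteq> (0, 0, 0) \<Longrightarrow> size0 w < size0 y \<Longrightarrow> err \<xi> x \<le> err \<xi> w"
      using next_minimal_point[OF x] by blast
    have "size0 y > 0" using y(2) size0_nonneg[of x] by linarith
    then have "size0 y \<ge> 1" by (cases y) simp
    with y show ?thesis by blast
  qed
  obtain x where x: "\<And>i. minimal_point \<xi> (x i) \<and> size0 (x i) \<ge> 1"
    "\<And>i. size0 (x i) < size0 (x (Suc i)) \<and> err \<xi> (x (Suc i)) < err \<xi> (x i) \<and>
      (\<forall>w. w \<noteq> (0, 0, 0) \<and> size0 w < size0 (x (Suc i)) \<longrightarrow> err \<xi> (x i) \<le> err \<xi> w)"
  proof (rule dependent_nat_choice[of "\<lambda>i x. minimal_point \<xi> x \<and> size0 x \<ge> 1"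
    "\<lambda>i x y. size0 x < size0 y \<and> err \<xi> y < err \<xi> x \<and> (\<forall>w. w \<noteq> (0, 0, 0) \<and> size0 w < size0 y \<longrightarrow> err \<xi> x \<le> err \<xi> w)", THEN exE])
    show "\<exists>x. minimal_point \<xi> x \<and> size0 x \<ge> 1" using step[OF \<open>minimal_point \<xi> m\<close>] by blast
  qed (use step in blast)+
  have "minimal_sequence \<xi> (2 * c) x"
  proof
    fix i
    have 1: "size0 (x (Suc i)) > size0 (x i)" "size0 (x i) \<ge> 1" using x by auto
    then have two: "size0 (x (Suc i)) \<ge> 2" using size0_less_imp[of "x i" "x (Suc i)"] by linarith
    define X where "X = size0 (x (Suc i)) / 2"
    have "X \<ge> 1" using two by (simp add: X_def)
    then obtain z where z: "z \<noteq> (0, 0, 0)" "size0 z \<le> X" "err \<xi> z \<le> c * X powr (1 - \<gamma>)" using D by blast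
    have "size0 z < size0 (x (Suc i))" using z(2) two by (simp add: X_def)
    then have "err \<xi> (x i) \<le> err \<xi> z" using x(2) z(1) by blast
    also note z(3)
    also have "X powr (1 - \<gamma>) = size0 (x (Suc i)) powr (1 - \<gamma>) * 2 powr (\<gamma> - 1)"
      using two unfolding X_def by (simp add: powr_divide powr_diff)
    also have "(2::real) powr (\<gamma> - 1) \<le> 2 powr 1" using golden_ratio_bounds by (intro powr_mono) auto
    finally show "err \<xi> (x i) \<le> 2 * c * size0 (x (Suc i)) powr (1 - \<gamma>)"
      using c by (simp add: mult_right_mono mult_left_mono algebra_simps)
  qed (use x irr in blast)+
  then show thesis by (rule that)
qed

section \<open>Turning points among the minimal points\<close>

context minimal_sequence
begin

abbreviation X :: "nat \<Rightarrow> real" where "X i \<equiv> size0 (x i)"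
abbreviation L :: "nat \<Rightarrow> real" where "L i \<equiv> err \<xi> (x i)"

lemma X_strict_mono: "i < j \<Longrightarrow> X i < X j"
  using size_Suc by (rule lift_Suc_mono_less)

lemma X_mono: "i \<le> j \<Longrightarrow> X i \<le> X j"
  using X_strict_mono[of i j] by (cases "i = j") auto

lemma L_strict_antimono: "i < j \<Longrightarrow> L j < L i"
  using lift_Suc_mono_less[of "\<lambda>i. - L i" i j] err_Suc by simp

lemma X_ge: "real i + 1 \<le> X i"
proof (induction i)
  case (Suc i)
  then show ?case using size0_less_imp[OF size_Suc[of i]] by simp
qed (use size_ge_1 in simp)

lemma X_pos: "X i > 0" using size_ge_1[of i] by linarith

lemma L_pos: "L i > 0"
proof (rule err_pos[OF not_quadratic])
  show "x i \<noteq> (0, 0, 0)" using size_ge_1[of i] by auto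
qed

lemma c_pos: "c > 0"
  using less_le_trans[OF L_pos err_le[of 0]] X_pos[of "Suc 0"] by (simp add: zero_less_mult_iff)

lemma L_le_c: "L i \<le> c"
proof -
  have "X (Suc i) powr (1 - \<gamma>) \<le> X (Suc i) powr 0"
    using size_ge_1[of "Suc i"] golden_ratio_gt_1 by (intro powr_mono) auto
  then have "c * X (Suc i) powr (1 - \<gamma>) \<le> c * 1"
    using c_pos X_pos[of "Suc i"] by (intro mult_left_mono) auto
  then show ?thesis using err_le[of i] by simp
qed

lemma L_le_c_X: "L i \<le> c * X j"
proof -
  have "c * 1 \<le> c * X j" using c_pos size_ge_1[of j] by (intro mult_left_mono) auto
  then show ?thesis using L_le_c[of i] by linarith
qed

text \<open>Dependent points have proportional sizes and errors, while here the sizes increase and the errors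
  decrease.\<close>

lemma cross_ne_0:
  assumes "i < j"
  shows "cross (x i) (x j) \<noteq> (0, 0, 0)"
proof
  assume "cross (x i) (x j) = (0, 0, 0)"
  then have "X j * L i \<le> X i * L j" using size0_err_le_cross[of "x j" \<xi> "x i"] by simp
  moreover have "X i * L j < X j * L j" using X_strict_mono[OF assms] L_pos by simp
  moreover have "X j * L j < X j * L i" using L_strict_antimono[OF assms] X_pos by simp
  ultimately show False by linarith
qed

text \<open>If the determinant of a minimal point of size \<open>X\<close> vanishes, comparison with its predecessor, whose error is at
  most \<open>c X powr (1 - \<gamma>)\<close>, gives \<open>sqrt X \<le> K X powr (2 - \<gamma>)\<close>. This bounds \<open>X\<close> because \<open>2 - \<gamma> < 2/5 < 1/2\<close>.\<close>

lemma eventually_det2_ne_0: "\<exists>N. \<forall>i\<ge>N. det2 (x i) \<noteq> 0"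
proof -
  define K where "K = (2 * (1 + \<bar>\<xi>\<bar>) + c) * c"
  have K: "K > 0" using c_pos by (simp add: K_def add_pos_pos)
  have bound: "X (Suc i) \<le> K powr 10" if "det2 (x (Suc i)) = 0" for i
  proof -
    let ?x = "x (Suc i)" and ?y = "x i"
    have indep: "cross ?x ?y \<noteq> (0, 0, 0)"
      using cross_ne_0[of i "Suc i"] by (cases ?x; cases ?y) (auto simp: algebra_simps)
    have 1: "X i * L (Suc i) \<le> X (Suc i) * L i"
      using X_mono[of i "Suc i"] L_strict_antimono[of i "Suc i"] L_pos[of "Suc i"] X_pos[of "Suc i"]
      by (intro mult_mono) auto
    have 2: "L (Suc i) * L i \<le> c * X (Suc i) * L i" using L_le_c_X L_pos[of i] by (intro mult_right_mono) auto
    have "sqrt (X (Suc i)) \<le> (1 + \<bar>\<xi>\<bar>) * (X (Suc i) * L i + X i * L (Suc i)) + L (Suc i) * L i"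
      by (rule degenerate_point_size_le[OF that X_pos indep])
    also have "\<dots> \<le> (1 + \<bar>\<xi>\<bar>) * (2 * (X (Suc i) * L i)) + c * X (Suc i) * L i"
      using 1 2 by (intro add_mono mult_left_mono) (auto simp: mult.commute)
    also have "\<dots> = (2 * (1 + \<bar>\<xi>\<bar>) + c) * (X (Suc i) * L i)" by (simp add: algebra_simps)
    also have "\<dots> \<le> (2 * (1 + \<bar>\<xi>\<bar>) + c) * (X (Suc i) * (c * X (Suc i) powr (1 - \<gamma>)))"
      using err_le[of i] X_pos[of "Suc i"] c_pos by (intro mult_left_mono) auto
    also have "\<dots> = K * (X (Suc i) powr 1 * X (Suc i) powr (1 - \<gamma>))"
      using X_pos[of "Suc i"] by (simp add: K_def)
    also have "\<dots> = K * X (Suc i) powr (2 - \<gamma>)" unfolding powr_add[symmetric] by simp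
    also have "\<dots> \<le> K * X (Suc i) powr (2/5)"
      using K size_ge_1[of "Suc i"] golden_ratio_bounds by (intro mult_left_mono powr_mono) auto
    finally have "X (Suc i) powr (1/2) \<le> K * X (Suc i) powr (2/5)"
      using X_pos[of "Suc i"] by (simp add: powr_half_sqrt)
    then have "X (Suc i) powr (1/2) / X (Suc i) powr (2/5) \<le> K"
      using X_pos[of "Suc i"] by (simp add: divide_le_eq)
    then have "X (Suc i) powr (1/10) \<le> K" by (simp flip: powr_diff)
    then have "(X (Suc i) powr (1/10)) powr 10 \<le> K powr 10" by (intro powr_mono2) auto
    then show ?thesis using X_pos[of "Suc i"] by (simp add: powr_powr)
  qed
  obtain N :: nat where N: "K powr 10 \<le> real N" using real_arch_simple by blast
  have "det2 (x i) \<noteq> 0" if i: "i \<ge> Suc N" for i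
  proof
    assume det: "det2 (x i) = 0"
    obtain j where j: "i = Suc j" using i by (cases i) auto
    have "X i \<le> K powr 10" using bound det unfolding j by blast
    moreover have "real N + 1 \<le> X i" using X_ge[of i] i by linarith
    ultimately show False using N by linarith
  qed
  then show ?thesis by blast
qed

text \<open>At a turn the plane spanned by two consecutive minimal points changes. The point of interest
  is the middle one, \<open>x (Suc j)\<close>, which lies in both planes.\<close>

definition turn :: "nat \<Rightarrow> bool" where
  "turn j \<longleftrightarrow> det3 (x j) (x (Suc j)) (x (Suc (Suc j))) \<noteq> 0"

lemma plane_until_turn:
  assumes "i \<le> m" "\<And>k. i \<le> k \<Longrightarrow> k < m \<Longrightarrow> \<not> turn k"
  shows "dot (cross (x i) (x (Suc i))) (x m) = 0 \<and> dot (cross (x i) (x (Suc i))) (x (Suc m)) = 0"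
  using assms
proof (induction m rule: dec_induct)
  case base
  show ?case by (simp add: dot_cross_self)
next
  case (step m)
  let ?v = "cross (x i) (x (Suc i))"
  have IH: "dot ?v (x m) = 0" "dot ?v (x (Suc m)) = 0" using step by auto
  have "dot ?v (x (Suc (Suc m))) = 0 \<longleftrightarrow> det3 (x m) (x (Suc m)) (x (Suc (Suc m))) = 0"
    by (rule orthogonal_iff_det3_eq_0[OF IH]) (simp_all add: cross_ne_0)
  then show ?case using IH step.prems[of m] step.hyps by (auto simp: turn_def)
qed

text \<open>Otherwise all late points are orthogonal to one integer vector \<open>v\<close>. As the sizes tend to infinity,
  the polynomial with coefficients \<open>v\<close> vanishes at \<open>\<xi>\<close>.\<close>

lemma infinitely_many_turns: "\<exists>j\<ge>N. turn j"
proof (rule ccontr)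
  assume no: "\<not> (\<exists>j\<ge>N. turn j)"
  define v where "v = cross (x N) (x (Suc N))"
  have v0: "v \<noteq> (0, 0, 0)" by (simp add: v_def cross_ne_0)
  then have "eval_at \<xi> v \<noteq> 0" using not_quadratic by blast
  then have P: "\<bar>eval_at \<xi> v\<bar> > 0" by simp
  obtain k :: nat where k: "2 * max_norm v * c / \<bar>eval_at \<xi> v\<bar> \<le> real k" using real_arch_simple by blast
  have "dot v (x (N + k)) = 0" using plane_until_turn[of N "N + k"] no by (simp add: v_def)
  then have "X (N + k) * \<bar>eval_at \<xi> v\<bar> \<le> 2 * max_norm v * L (N + k)"
    using size0_eval_le[of "x (N + k)" \<xi> v] by simp
  also have "\<dots> \<le> 2 * max_norm v * c" using L_le_c max_norm_nonneg by (intro mult_left_mono) auto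
  also have "\<dots> \<le> real k * \<bar>eval_at \<xi> v\<bar>" using k P by (simp add: divide_le_eq)
  finally have "X (N + k) \<le> real k" using P by simp
  then show False using X_ge[of "N + k"] by simp
qed

text \<open>A nonzero determinant bounds size times error from below, which limits the size of the next point:
  that size, raised to \<open>1/\<gamma>\<close>, is at most a multiple of the present one.\<close>

lemma det2_growth:
  assumes "det2 (x i) \<noteq> 0"
  shows "X (Suc i) powr (\<gamma> - 1) \<le> (1 + 2 * \<bar>\<xi>\<bar> + c) * c * X i"
proof -
  have "1 \<le> \<bar>real_of_int (det2 (x i))\<bar>" using assms by linarith
  also have "\<dots> \<le> (1 + 2 * \<bar>\<xi>\<bar>) * X i * L i + (L i)\<^sup>2" using abs_det2_le[of "x i" \<xi>] by simp
  also have "(L i)\<^sup>2 \<le> c * X i * L i"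
    using L_le_c_X[of i i] L_pos[of i] by (simp add: power2_eq_square mult_right_mono)
  also have "(1 + 2 * \<bar>\<xi>\<bar>) * X i * L i + c * X i * L i = (1 + 2 * \<bar>\<xi>\<bar> + c) * X i * L i"
    by (simp add: algebra_simps)
  also have "\<dots> \<le> (1 + 2 * \<bar>\<xi>\<bar> + c) * X i * (c * X (Suc i) powr (1 - \<gamma>))"
    using err_le[of i] X_pos[of i] c_pos by (intro mult_left_mono) auto
  finally have "X (Suc i) powr (\<gamma> - 1) * 1 \<le> X (Suc i) powr (\<gamma> - 1) * ((1 + 2 * \<bar>\<xi>\<bar> + c) * X i * (c * X (Suc i) powr (1 - \<gamma>)))"
    by (intro mult_left_mono) auto
  also have "\<dots> = (X (Suc i) powr (\<gamma> - 1) * X (Suc i) powr (1 - \<gamma>)) * ((1 + 2 * \<bar>\<xi>\<bar> + c) * c * X i)"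
    by (simp only: mult_ac)
  also have "X (Suc i) powr (\<gamma> - 1) * X (Suc i) powr (1 - \<gamma>) = 1"
    using X_pos[of "Suc i"] by (simp flip: powr_add)
  finally show ?thesis by simp
qed

text \<open>Of the three terms in the bound for the determinant of three minimal points, the one with the
  largest size and the two largest errors dominates.\<close>

lemma turn_lower_bound:
  assumes "turn j"
  shows "1 \<le> 6 * X (Suc (Suc j)) * L (Suc j) * L j"
proof -
  let ?u = "Suc j" and ?w = "Suc (Suc j)"
  have "1 \<le> \<bar>real_of_int (det3 (x j) (x ?u) (x ?w))\<bar>" using assms unfolding turn_def by linarith
  also have "\<dots> \<le> 2 * (X j * L ?u * L ?w + X ?u * L j * L ?w + X ?w * L j * L ?u)"
    using abs_det3_le[of "x j" "x ?u" "x ?w" \<xi>] by simp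
  also have "X j * L ?u * L ?w \<le> X ?w * L ?u * L j"
    using X_mono[of j ?w] L_strict_antimono[of j ?w] L_pos X_pos
    by (intro mult_mono) (auto simp: less_imp_le)
  also have "X ?u * L j * L ?w \<le> X ?w * L j * L ?u"
    using X_mono[of ?u ?w] L_strict_antimono[of ?u ?w] L_pos X_pos
    by (intro mult_mono) (auto simp: less_imp_le)
  finally show ?thesis by (simp add: mult_ac)
qed

text \<open>Inserting the upper bounds for both errors in \<open>turn_lower_bound\<close> shows that the size after the turn
  is at least of order \<open>X\<^sup>\<gamma>\<close>, where \<open>X\<close> is the size of the middle point; so its error is at most of order \<open>1/X\<close>.\<close>

lemma turn_err_le:
  assumes "turn j"
  shows "X (Suc j) * L (Suc j) \<le> c * (6 * c\<^sup>2) powr \<gamma>"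
proof -
  let ?u = "Suc j" and ?w = "Suc (Suc j)"
  have "1 \<le> 6 * X ?w * L ?u * L j" by (rule turn_lower_bound[OF assms])
  also have "\<dots> \<le> 6 * X ?w * (c * X ?w powr (1 - \<gamma>)) * (c * X ?u powr (1 - \<gamma>))"
    using err_le[of ?u] err_le[of j] L_pos X_pos by (intro mult_mono) (auto simp: less_imp_le c_pos)
  also have "\<dots> = 6 * c\<^sup>2 * ((X ?w powr 1 * X ?w powr (1 - \<gamma>)) * X ?u powr (1 - \<gamma>))"
    using X_pos[of ?w] by (simp add: power2_eq_square mult_ac)
  also have "X ?w powr 1 * X ?w powr (1 - \<gamma>) = X ?w powr (2 - \<gamma>)" unfolding powr_add[symmetric] by simp
  finally have "X ?u powr (\<gamma> - 1) * 1 \<le> X ?u powr (\<gamma> - 1) * (6 * c\<^sup>2 * (X ?w powr (2 - \<gamma>) * X ?u powr (1 - \<gamma>)))"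
    by (intro mult_left_mono) auto
  also have "\<dots> = (X ?u powr (\<gamma> - 1) * X ?u powr (1 - \<gamma>)) * (6 * c\<^sup>2 * X ?w powr (2 - \<gamma>))"
    by (simp only: mult_ac)
  also have "X ?u powr (\<gamma> - 1) * X ?u powr (1 - \<gamma>) = 1" using X_pos[of ?u] by (simp flip: powr_add)
  finally have "X ?u powr (\<gamma> - 1) \<le> 6 * c\<^sup>2 * X ?w powr (2 - \<gamma>)" by simp
  then have "(X ?u powr (\<gamma> - 1)) powr \<gamma> \<le> (6 * c\<^sup>2 * X ?w powr (2 - \<gamma>)) powr \<gamma>"
    using golden_ratio_gt_1 by (intro powr_mono2) auto
  moreover have "(\<gamma> - 1) * \<gamma> = 1" "(2 - \<gamma>) * \<gamma> = \<gamma> - 1"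
    using golden_ratio_square by (simp_all add: algebra_simps power2_eq_square)
  ultimately have u: "X ?u \<le> (6 * c\<^sup>2) powr \<gamma> * X ?w powr (\<gamma> - 1)"
    using X_pos[of ?u] by (simp add: powr_mult powr_powr)
  have "X ?u * L ?u \<le> ((6 * c\<^sup>2) powr \<gamma> * X ?w powr (\<gamma> - 1)) * (c * X ?w powr (1 - \<gamma>))"
    using u err_le[of ?u] L_pos X_pos by (intro mult_mono) (auto simp: less_imp_le)
  also have "\<dots> = c * (6 * c\<^sup>2) powr \<gamma> * (X ?w powr (\<gamma> - 1) * X ?w powr (1 - \<gamma>))"
    by (simp only: mult_ac)
  also have "X ?w powr (\<gamma> - 1) * X ?w powr (1 - \<gamma>) = 1" using X_pos[of ?w] by (simp flip: powr_add)
  finally show ?thesis by simp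
qed

text \<open>Here only the later error in \<open>turn_lower_bound\<close> is replaced by its upper bound. The point before the turn then
  has, up to a constant, the largest error that extremality permits.\<close>

lemma turn_err_ge:
  assumes "turn j" "det2 (x (Suc j)) \<noteq> 0"
  shows "X (Suc j) powr (1 - \<gamma>) \<le> 6 * c * ((1 + 2 * \<bar>\<xi>\<bar> + c) * c) powr (\<gamma> - 1) * L j"
proof -
  let ?u = "Suc j" and ?w = "Suc (Suc j)" and ?K = "(1 + 2 * \<bar>\<xi>\<bar> + c) * c"
  have K: "?K > 0" using c_pos by (simp add: add_pos_pos)
  have e: "(\<gamma> - 1) * (\<gamma> - 1) = 2 - \<gamma>"
    using golden_ratio_square by (simp_all add: algebra_simps power2_eq_square)
  have "1 \<le> 6 * X ?w * L ?u * L j" by (rule turn_lower_bound[OF assms(1)])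
  also have "\<dots> \<le> 6 * X ?w * (c * X ?w powr (1 - \<gamma>)) * L j"
    using err_le[of ?u] L_pos[of j] X_pos[of ?w] by (intro mult_right_mono mult_left_mono) auto
  also have "\<dots> = 6 * c * (X ?w powr 1 * X ?w powr (1 - \<gamma>)) * L j"
    using X_pos[of ?w] by (simp add: mult_ac)
  also have "X ?w powr 1 * X ?w powr (1 - \<gamma>) = X ?w powr (2 - \<gamma>)" unfolding powr_add[symmetric] by simp
  also have "X ?w powr (2 - \<gamma>) = (X ?w powr (\<gamma> - 1)) powr (\<gamma> - 1)" by (simp add: powr_powr e)
  also have "6 * c * (X ?w powr (\<gamma> - 1)) powr (\<gamma> - 1) * L j \<le> 6 * c * (?K * X ?u) powr (\<gamma> - 1) * L j"
    using det2_growth[OF assms(2)] golden_ratio_gt_1 c_pos L_pos[of j]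
    by (intro mult_right_mono mult_left_mono powr_mono2) auto
  also have "(?K * X ?u) powr (\<gamma> - 1) = ?K powr (\<gamma> - 1) * X ?u powr (\<gamma> - 1)"
    using K X_pos[of ?u] by (simp add: powr_mult)
  finally have "X ?u powr (1 - \<gamma>) * 1 \<le> X ?u powr (1 - \<gamma>) * (6 * c * (?K powr (\<gamma> - 1) * X ?u powr (\<gamma> - 1)) * L j)"
    by (intro mult_left_mono) auto
  also have "\<dots> = (X ?u powr (1 - \<gamma>) * X ?u powr (\<gamma> - 1)) * (6 * c * ?K powr (\<gamma> - 1) * L j)"
    by (simp only: mult_ac)
  also have "X ?u powr (1 - \<gamma>) * X ?u powr (\<gamma> - 1) = 1" using X_pos[of ?u] by (simp flip: powr_add)
  finally show ?thesis by simp
qed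

lemma orthogonal_consecutive:
  assumes "dot v (x i) = 0" "dot v (x j) = 0" "i < j" "v \<noteq> (0, 0, 0)"
    and "dot w (x i) = 0" "dot w (x j) = 0" "w \<noteq> (0, 0, 0)"
  shows "dot v z = 0 \<longleftrightarrow> dot w z = 0"
  using orthogonal_iff_det3_eq_0[of v "x i" "x j" z] orthogonal_iff_det3_eq_0[of w "x i" "x j" z]
    assms cross_ne_0[of i j] by blast

text \<open>As long as no turn occurs, all points lie in one plane, and \<open>x j\<close>, \<open>x (Suc j)\<close> is a basis of its lattice of
  integer points. The cross product of any other pair of lattice points is an integer multiple of theirs.\<close>

lemma cross_norm_le_at_turn:
  assumes "i \<le> j" "\<And>k. i \<le> k \<Longrightarrow> k < j \<Longrightarrow> \<not> turn k"
  shows "max_norm (cross (x j) (x (Suc j))) \<le> max_norm (cross (x i) (x (Suc i)))"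
proof -
  let ?v = "cross (x i) (x (Suc i))" and ?w = "cross (x j) (x (Suc j))"
  have v: "dot ?v (x j) = 0" "dot ?v (x (Suc j)) = 0" using plane_until_turn[OF assms] by auto
  have eq: "dot ?v z = 0 \<longleftrightarrow> dot ?w z = 0" for z
    by (rule orthogonal_consecutive[OF v]) (simp_all add: dot_cross_self cross_ne_0)
  have w: "dot ?w (x i) = 0" "dot ?w (x (Suc i)) = 0"
    by (rule iffD1[OF eq dot_cross_self(1)], rule iffD1[OF eq dot_cross_self(2)])
  have basis: "\<exists>a b. z = lin_comb a (x j) b (x (Suc j))" if "dot ?w z = 0" for z
    using lattice_basis_of_minimal[OF cross_ne_0[OF lessI] size_Suc err_Suc err_min that] by blast
  obtain a b where ab: "x i = lin_comb a (x j) b (x (Suc j))" using basis[OF w(1)] by blast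
  obtain c d where cd: "x (Suc i) = lin_comb c (x j) d (x (Suc j))" using basis[OF w(2)] by blast
  have v_eq: "?v = lin_comb (a * d - b * c) ?w 0 ?w" unfolding ab cd by (rule cross_lin_comb)
  have "?v \<noteq> (0, 0, 0)" by (rule cross_ne_0) simp
  then have "a * d - b * c \<noteq> 0" using v_eq by (cases ?w) auto
  then have "\<bar>a * d - b * c\<bar> \<ge> 1" by linarith
  then have "1 * max_norm ?w \<le> real_of_int \<bar>a * d - b * c\<bar> * max_norm ?w"
    using max_norm_nonneg by (intro mult_right_mono) linarith+
  also have "\<dots> = max_norm ?v" unfolding v_eq max_norm_scale by simp
  finally show ?thesis by simp
qed

text \<open>Let \<open>i < j\<close> be consecutive turns, with middle points of sizes \<open>A\<close> and \<open>B\<close>. By \<open>turn_err_ge\<close>,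
  \<open>B\<^bsup>2-\<gamma>\<^esup>\<close> is at most of order \<open>B L\<^sub>j\<close>, and this is at most of order the norm of \<open>x\<^sub>j \<times> x\<^sub>j\<^sub>+\<^sub>1\<close>, because the other term
  \<open>X\<^sub>j L\<^sub>j\<^sub>+\<^sub>1\<close> is bounded by \<open>turn_err_le\<close> and the norm is at least 1. The norm is not larger than that of
  \<open>x\<^sub>i\<^sub>+\<^sub>1 \<times> x\<^sub>i\<^sub>+\<^sub>2\<close>, which is at most of order \<open>X\<^sub>i\<^sub>+\<^sub>2 L\<^sub>i\<^sub>+\<^sub>1\<close>, hence of \<open>A\<^bsup>\<gamma>-1\<^esup>\<close>. Raising to the power
  \<open>\<gamma> + 1\<close> gives \<open>B \<le> K A\<^sup>\<gamma>\<close>.\<close>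

lemma turn_growth: "\<exists>K>0. \<forall>i j. i < j \<longrightarrow> turn j \<longrightarrow> (\<forall>k. i < k \<longrightarrow> k < j \<longrightarrow> \<not> turn k) \<longrightarrow>
   det2 (x (Suc i)) \<noteq> 0 \<longrightarrow> det2 (x (Suc j)) \<noteq> 0 \<longrightarrow> X (Suc j) \<le> K * X (Suc i) powr \<gamma>"
proof -
  define K1 where "K1 = (1 + 2 * \<bar>\<xi>\<bar> + c) * c"
  define K2 where "K2 = c * (6 * c\<^sup>2) powr \<gamma>"
  define K4 where "K4 = 6 * c * K1 powr (\<gamma> - 1)"
  define M where "M = 2 + \<bar>\<xi>\<bar> + \<xi>\<^sup>2"
  define K5 where "K5 = K4 * ((K2 + 1) * (M * ((2 + c) * (c * K1 powr (\<gamma> - 1)))))"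
  have K1: "K1 > 0" using c_pos by (simp add: K1_def add_pos_pos)
  have K2: "K2 > 0" and K4: "K4 > 0" using c_pos K1 by (simp_all add: K2_def K4_def)
  have M: "M > 0" unfolding M_def by (intro add_pos_nonneg) auto
  have K5: "K5 > 0" using K1 K2 K4 M c_pos by (simp add: K5_def add_pos_pos)
  have e: "(\<gamma> - 1) * (\<gamma> - 1) = 2 - \<gamma>" "(2 - \<gamma>) * (\<gamma> + 1) = 1" "(\<gamma> - 1) * (\<gamma> + 1) = \<gamma>"
    using golden_ratio_square by (simp_all add: algebra_simps power2_eq_square)
  have "X (Suc j) \<le> K5 powr (\<gamma> + 1) * X (Suc i) powr \<gamma>"
    if ij: "i < j" "turn j" "\<And>k. i < k \<Longrightarrow> k < j \<Longrightarrow> \<not> turn k"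
      and det: "det2 (x (Suc i)) \<noteq> 0" "det2 (x (Suc j)) \<noteq> 0" for i j
  proof -
    let ?a = "Suc i" and ?b = "Suc (Suc i)" and ?n = "max_norm (cross (x (Suc i)) (x (Suc (Suc i))))"
    have n1: "?n \<ge> 1" by (rule max_norm_ge_1) (simp add: cross_ne_0)
    have "X (Suc j) * L j \<le> X j * L (Suc j) + max_norm (cross (x j) (x (Suc j)))"
      by (rule size0_err_le_cross)
    also have "max_norm (cross (x j) (x (Suc j))) \<le> ?n"
      by (rule cross_norm_le_at_turn) (use ij in auto)
    also have "X j * L (Suc j) \<le> X (Suc j) * L (Suc j)"
      using X_mono[of j "Suc j"] L_pos[of "Suc j"] by (intro mult_right_mono) auto
    also have "\<dots> \<le> K2" using turn_err_le[OF ij(2)] by (simp add: K2_def)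
    also have "K2 \<le> K2 * ?n" using K2 n1 by simp
    finally have XL: "X (Suc j) * L j \<le> (K2 + 1) * ?n" by (simp add: algebra_simps)
    have "?n \<le> M * (X ?a * L ?b + X ?b * L ?a + L ?a * L ?b)"
      unfolding M_def by (rule max_norm_cross_le)
    also have "\<dots> \<le> M * ((2 + c) * (X ?b * L ?a))"
    proof (intro mult_left_mono)
      have "X ?a * L ?b \<le> X ?b * L ?a"
        using X_mono[of ?a ?b] L_strict_antimono[of ?a ?b] L_pos X_pos by (intro mult_mono) (auto simp: less_imp_le)
      moreover have "L ?a * L ?b \<le> c * X ?b * L ?a"
        using L_le_c_X[of ?b ?b] L_pos[of ?a] by (simp add: mult.commute)
      ultimately show "X ?a * L ?b + X ?b * L ?a + L ?a * L ?b \<le> (2 + c) * (X ?b * L ?a)"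
        by (simp add: algebra_simps)
    qed (use M in simp)
    also have "X ?b * L ?a \<le> c * K1 powr (\<gamma> - 1) * X ?a powr (\<gamma> - 1)"
    proof -
      have "X ?b * L ?a \<le> X ?b * (c * X ?b powr (1 - \<gamma>))"
        using err_le[of ?a] X_pos[of ?b] by (intro mult_left_mono) auto
      also have "\<dots> = c * (X ?b powr 1 * X ?b powr (1 - \<gamma>))" using X_pos[of ?b] by simp
      also have "X ?b powr 1 * X ?b powr (1 - \<gamma>) = X ?b powr (2 - \<gamma>)"
        unfolding powr_add[symmetric] by simp
      also have "\<dots> = (X ?b powr (\<gamma> - 1)) powr (\<gamma> - 1)" by (simp add: powr_powr e)
      also have "c * \<dots> \<le> c * (K1 * X ?a) powr (\<gamma> - 1)"
        using det2_growth[OF det(1)] golden_ratio_gt_1 c_pos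
        by (intro mult_left_mono powr_mono2) (auto simp: K1_def)
      finally show ?thesis using K1 X_pos[of ?a] by (simp add: powr_mult)
    qed
    finally have n: "?n \<le> M * ((2 + c) * (c * K1 powr (\<gamma> - 1) * X ?a powr (\<gamma> - 1)))"
      using M c_pos by (simp add: mult_left_mono)
    have "X (Suc j) powr (2 - \<gamma>) = X (Suc j) powr 1 * X (Suc j) powr (1 - \<gamma>)"
      unfolding powr_add[symmetric] by simp
    also have "\<dots> \<le> X (Suc j) * (K4 * L j)"
      using turn_err_ge[OF ij(2) det(2)] X_pos[of "Suc j"] by (simp add: K4_def K1_def mult_left_mono)
    also have "\<dots> = K4 * (X (Suc j) * L j)" by simp
    also have "\<dots> \<le> K4 * ((K2 + 1) * (M * ((2 + c) * (c * K1 powr (\<gamma> - 1) * X ?a powr (\<gamma> - 1)))))"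
      using K4 K2 by (intro mult_left_mono order_trans[OF XL] n) auto
    also have "\<dots> = K5 * X ?a powr (\<gamma> - 1)" by (simp add: K5_def)
    finally have "(X (Suc j) powr (2 - \<gamma>)) powr (\<gamma> + 1) \<le> (K5 * X ?a powr (\<gamma> - 1)) powr (\<gamma> + 1)"
      using golden_ratio_gt_1 by (intro powr_mono2) auto
    then show ?thesis using X_pos K5 by (simp add: powr_mult powr_powr e less_imp_le)
  qed
  moreover have "K5 powr (\<gamma> + 1) > 0" using K5 by simp
  ultimately show ?thesis by blast
qed

text \<open>The planes before and after the turn \<open>j\<close> meet in the line of \<open>x (Suc j)\<close>. If the three middle points were
  dependent, the last one would lie in both planes, off that line.\<close>

lemma turns_det3_ne_0:
  assumes ij: "i < j" "\<And>k. i < k \<Longrightarrow> k < j \<Longrightarrow> \<not> turn k"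
    and jm: "j < m" "\<And>k. j < k \<Longrightarrow> k < m \<Longrightarrow> \<not> turn k" and turn: "turn j"
  shows "det3 (x (Suc i)) (x (Suc j)) (x (Suc m)) \<noteq> 0"
proof
  let ?v = "cross (x (Suc i)) (x (Suc (Suc i)))" and ?w = "cross (x (Suc j)) (x (Suc (Suc j)))"
  assume det: "det3 (x (Suc i)) (x (Suc j)) (x (Suc m)) = 0"
  have v: "dot ?v (x j) = 0" "dot ?v (x (Suc j)) = 0"
    using plane_until_turn[of "Suc i" j] ij by auto
  have w: "dot ?w (x (Suc m)) = 0" using plane_until_turn[of "Suc j" m] jm by auto
  have nz: "?v \<noteq> (0, 0, 0)" "?w \<noteq> (0, 0, 0)" by (simp_all add: cross_ne_0)
  have "dot ?v (x (Suc m)) = 0"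
    using orthogonal_iff_det3_eq_0[of ?v "x (Suc i)" "x (Suc j)" "x (Suc m)"] v nz det ij(1)
    by (simp add: dot_cross_self cross_ne_0)
  then have "dot ?v (x (Suc (Suc j))) = 0 \<longleftrightarrow> dot ?w (x (Suc (Suc j))) = 0"
    using orthogonal_consecutive[of ?v "Suc j" "Suc m" ?w] v w nz jm(1) by (simp add: dot_cross_self)
  then have "dot ?v (x (Suc (Suc j))) = 0" by (simp add: dot_cross_self)
  then have "det3 (x j) (x (Suc j)) (x (Suc (Suc j))) = 0"
    using orthogonal_iff_det3_eq_0[OF v nz(1)] by (simp add: cross_ne_0)
  with turn show False by (simp add: turn_def)
qed

end

text \<open>What remains of extremality: points whose sizes grow with exponent at most \<open>\<gamma>\<close>, whose errors are
  at most of the order of the reciprocal size, and which are nondegenerate singly and in consecutive triples.\<close>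

locale extremal_sequence =
  fixes \<xi> C :: real and y :: "nat \<Rightarrow> point"
  assumes not_quadratic: "eval_at \<xi> p = 0 \<Longrightarrow> p = (0, 0, 0)"
    and C_pos: "C > 0"
    and size_ge_1: "size0 (y k) \<ge> 1"
    and size_Suc: "size0 (y k) < size0 (y (Suc k))"
    and size_growth: "size0 (y (Suc k)) \<le> C * size0 (y k) powr \<gamma>"
    and size_err: "size0 (y k) * err \<xi> (y k) \<le> C"
    and det2: "det2 (y k) \<noteq> 0"
    and det3: "det3 (y k) (y (Suc k)) (y (Suc (Suc k))) \<noteq> 0"

lemma (in minimal_sequence) extremal_sequence_of_turns: "\<exists>C y. extremal_sequence \<xi> C y"
proof -
  obtain N where N: "\<And>i. i \<ge> N \<Longrightarrow> det2 (x i) \<noteq> 0" using eventually_det2_ne_0 by blast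
  obtain K where K: "K > 0" and growth: "\<And>i j. i < j \<Longrightarrow> turn j \<Longrightarrow> (\<And>k. i < k \<Longrightarrow> k < j \<Longrightarrow> \<not> turn k) \<Longrightarrow>
   det2 (x (Suc i)) \<noteq> 0 \<Longrightarrow> det2 (x (Suc j)) \<noteq> 0 \<Longrightarrow> X (Suc j) \<le> K * X (Suc i) powr \<gamma>"
    using turn_growth by blast
  define T where "T = {j. j \<ge> N \<and> turn j}"
  have inf: "infinite T"
    unfolding infinite_nat_iff_unbounded_le
  proof
    fix m
    obtain j where "j \<ge> max m N" "turn j" using infinitely_many_turns by blast
    then show "\<exists>n\<ge>m. n \<in> T" by (auto simp: T_def)
  qed
  define t where "t = enumerate T"
  have t: "t k \<in> T" for k unfolding t_def by (rule enumerate_in_set[OF inf])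
  have t_less: "t k < t (Suc k)" for k unfolding t_def by (rule enumerate_step[OF inf])
  have gap: "\<not> turn i" if "t k < i" "i < t (Suc k)" for i k
  proof
    assume "turn i"
    then have "i \<in> T" using that(1) t[of k] by (auto simp: T_def)
    then have "t (Suc k) \<le> i"
      using that(1) enumerate_Suc''[OF inf, of k] unfolding t_def by (metis (mono_tags, lifting) Least_le)
    with that(2) show False by simp
  qed
  have turn: "turn (t k)" and det2: "det2 (x (Suc (t k))) \<noteq> 0" for k
    using t[of k] N[of "Suc (t k)"] by (auto simp: T_def)
  define C where "C = max K (c * (6 * c\<^sup>2) powr \<gamma>)"
  have "extremal_sequence \<xi> C (\<lambda>k. x (Suc (t k)))"
  proof
    show "p = (0, 0, 0)" if "eval_at \<xi> p = 0" for p by (rule not_quadratic[OF that])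
    show "C > 0" using K by (simp add: C_def)
    show "X (Suc (t k)) \<ge> 1" for k by (rule size_ge_1)
    show "X (Suc (t k)) < X (Suc (t (Suc k)))" for k using t_less by (intro X_strict_mono) simp
    show "X (Suc (t (Suc k))) \<le> C * X (Suc (t k)) powr \<gamma>" for k
    proof -
      have "X (Suc (t (Suc k))) \<le> K * X (Suc (t k)) powr \<gamma>"
        by (rule growth[OF t_less turn gap det2 det2])
      also have "\<dots> \<le> C * X (Suc (t k)) powr \<gamma>" by (intro mult_right_mono) (auto simp: C_def)
      finally show ?thesis .
    qed
    show "X (Suc (t k)) * L (Suc (t k)) \<le> C" for k
      using turn_err_le[OF turn[of k]] by (simp add: C_def)
    show "det2 (x (Suc (t k))) \<noteq> 0" for k by (rule det2)
    show "det3 (x (Suc (t k))) (x (Suc (t (Suc k)))) (x (Suc (t (Suc (Suc k))))) \<noteq> 0" for k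
      by (rule turns_det3_ne_0[OF t_less gap t_less gap turn])
  qed
  then show ?thesis by blast
qed

section \<open>Lower bounds for values of integer polynomials\<close>

context extremal_sequence
begin

abbreviation Y :: "nat \<Rightarrow> real" where "Y k \<equiv> size0 (y k)"

lemma Y_pos: "Y k > 0" using size_ge_1[of k] by linarith

lemma Y_mono: "i \<le> j \<Longrightarrow> Y i \<le> Y j"
  using lift_Suc_mono_less[of "\<lambda>i. Y i" i j] size_Suc by (cases "i = j") auto

lemma Y_ge: "real k + 1 \<le> Y k"
proof (induction k)
  case (Suc k)
  then show ?case using size0_less_imp[OF size_Suc[of k]] by simp
qed (use size_ge_1 in simp)

lemma err_y_le: "err \<xi> (y k) \<le> C / Y k"
  using size_err[of k] Y_pos[of k] by (simp add: field_simps)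

text \<open>Take the first \<open>Y k\<close> that reaches \<open>K H\<close>; its predecessor is below \<open>K H\<close>, and the growth bound applies.\<close>

lemma exists_scale:
  assumes "K > 0"
  shows "\<exists>B>0. \<forall>H\<ge>1. \<exists>k. K * H \<le> Y k \<and> Y k \<le> B * H powr \<gamma>"
proof -
  define B where "B = max (Y 0) (C * K powr \<gamma>)"
  have B: "B > 0" using Y_pos[of 0] by (simp add: B_def)
  have "\<exists>k. K * H \<le> Y k \<and> Y k \<le> B * H powr \<gamma>" if H: "H \<ge> 1" for H
  proof -
    obtain n :: nat where "K * H \<le> real n" using real_arch_simple by blast
    then have ex: "\<exists>k. K * H \<le> Y k" using Y_ge[of n] by (intro exI[of _ n]) linarith
    define k where "k = (LEAST k. K * H \<le> Y k)"
    have k: "K * H \<le> Y k" unfolding k_def by (rule LeastI_ex[OF ex])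
    have "Y k \<le> B * H powr \<gamma>"
    proof (cases k)
      case 0
      have "H powr 0 \<le> H powr \<gamma>" using H golden_ratio_gt_1 by (intro powr_mono) auto
      then have "B * 1 \<le> B * H powr \<gamma>" using B H by (intro mult_left_mono) auto
      moreover have "Y k \<le> B" by (simp add: B_def 0)
      ultimately show ?thesis by linarith
    next
      case (Suc j)
      then have "\<not> K * H \<le> Y j" using not_less_Least[of j "\<lambda>k. K * H \<le> Y k"] by (simp add: k_def)
      then have "Y j powr \<gamma> \<le> (K * H) powr \<gamma>" using golden_ratio_gt_1 Y_pos[of j] by (intro powr_mono2) auto
      then have "C * Y j powr \<gamma> \<le> C * (K * H) powr \<gamma>" using C_pos by simp
      also have "\<dots> = C * K powr \<gamma> * H powr \<gamma>" using assms H by (simp add: powr_mult)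
      also have "\<dots> \<le> B * H powr \<gamma>" by (intro mult_right_mono) (auto simp: B_def)
      finally show ?thesis using size_growth[of j] Suc by simp
    qed
    with k show ?thesis by blast
  qed
  with B show ?thesis by blast
qed

text \<open>A nonzero integer is at least 1 in absolute value, and at this scale the error contributes at
  most \<open>1/2\<close> to it.\<close>

lemma eval_at_lower_at_scale:
  assumes "dot p (y k) \<noteq> 0" "max_norm p \<le> H" "4 * C * H \<le> Y k"
  shows "1 \<le> 2 * Y k * \<bar>eval_at \<xi> p\<bar>"
proof -
  have "1 \<le> \<bar>real_of_int (dot p (y k))\<bar>" using assms(1) by linarith
  also have "\<dots> \<le> Y k * \<bar>eval_at \<xi> p\<bar> + 2 * max_norm p * err \<xi> (y k)" using abs_dot_le[of p "y k" \<xi>] by simp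
  finally have 1: "1 \<le> Y k * \<bar>eval_at \<xi> p\<bar> + 2 * max_norm p * err \<xi> (y k)" .
  have "4 * C * (max_norm p * err \<xi> (y k)) \<le> 4 * C * (H * err \<xi> (y k))"
    using assms(2) C_pos err_nonneg by (intro mult_left_mono mult_right_mono) auto
  also have "\<dots> = (4 * C * H) * err \<xi> (y k)" by simp
  also have "\<dots> \<le> Y k * err \<xi> (y k)" using assms(3) err_nonneg by (intro mult_right_mono) auto
  also have "\<dots> \<le> C" by (rule size_err)
  finally have "4 * (max_norm p * err \<xi> (y k)) \<le> 1" using C_pos by (simp add: field_simps)
  with 1 show ?thesis by linarith
qed

text \<open>A coefficient vector is not orthogonal to three independent points, so one of three consecutive
  \<open>y n\<close> can be used. Reaching the scale costs the exponent \<open>\<gamma>\<close>, and two more steps multiply it by \<open>\<gamma>\<^sup>2\<close>: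
  \<open>\<gamma>\<^sup>3 = 2 \<gamma> + 1\<close>.\<close>

lemma eval_at_lower_bound:
  "\<exists>a>0. \<forall>p H. p \<noteq> (0, 0, 0) \<longrightarrow> max_norm p \<le> H \<longrightarrow> a \<le> \<bar>eval_at \<xi> p\<bar> * H powr (2 * \<gamma> + 1)"
proof -
  obtain B where B: "B > 0" and scale: "\<And>H. H \<ge> 1 \<Longrightarrow> \<exists>k. 4 * C * H \<le> Y k \<and> Y k \<le> B * H powr \<gamma>"
    using exists_scale[of "4 * C"] C_pos by auto
  define B2 where "B2 = C * (C * B powr \<gamma>) powr \<gamma>"
  have B2: "B2 > 0" using B C_pos by (simp add: B2_def)
  have e: "\<gamma> * \<gamma> = \<gamma> + 1" "(\<gamma> + 1) * \<gamma> = 2 * \<gamma> + 1"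
    using golden_ratio_square by (simp_all add: algebra_simps power2_eq_square)
  have "1 / (2 * B2) \<le> \<bar>eval_at \<xi> p\<bar> * H powr (2 * \<gamma> + 1)"
    if p: "p \<noteq> (0, 0, 0)" "max_norm p \<le> H" for p H
  proof -
    have H: "H \<ge> 1" using max_norm_ge_1[OF p(1)] p(2) by linarith
    obtain k where k: "4 * C * H \<le> Y k" "Y k \<le> B * H powr \<gamma>" using scale[OF H] by blast
    have "Y (Suc k) \<le> C * Y k powr \<gamma>" by (rule size_growth)
    also have "\<dots> \<le> C * (B * H powr \<gamma>) powr \<gamma>"
      using k(2) Y_pos[of k] C_pos golden_ratio_gt_1 by (intro mult_left_mono powr_mono2) auto
    also have "\<dots> = C * B powr \<gamma> * H powr (\<gamma> + 1)" using B H by (simp add: powr_mult powr_powr e)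
    finally have k1: "Y (Suc k) \<le> C * B powr \<gamma> * H powr (\<gamma> + 1)" .
    have "Y (Suc (Suc k)) \<le> C * Y (Suc k) powr \<gamma>" by (rule size_growth)
    also have "\<dots> \<le> C * (C * B powr \<gamma> * H powr (\<gamma> + 1)) powr \<gamma>"
      using k1 Y_pos[of "Suc k"] C_pos golden_ratio_gt_1 by (intro mult_left_mono powr_mono2) auto
    also have "\<dots> = B2 * H powr (2 * \<gamma> + 1)"
      using B C_pos H by (simp add: powr_mult[of "C * B powr \<gamma>"] powr_powr e B2_def)
    finally have k2: "Y (Suc (Suc k)) \<le> B2 * H powr (2 * \<gamma> + 1)" .
    have "\<exists>n. k \<le> n \<and> n \<le> Suc (Suc k) \<and> dot p (y n) \<noteq> 0"
    proof (rule ccontr)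
      assume "\<not> ?thesis"
      then have z: "dot p (y k) = 0" "dot p (y (Suc k)) = 0" "dot p (y (Suc (Suc k))) = 0" by auto
      have "cross (y k) (y (Suc k)) \<noteq> (0, 0, 0)"
        using det3[of k] by (cases "y (Suc (Suc k))") auto
      then show False using orthogonal_iff_det3_eq_0[OF z(1,2) p(1)] z(3) det3[of k] by blast
    qed
    then obtain n where n: "k \<le> n" "n \<le> Suc (Suc k)" "dot p (y n) \<noteq> 0" by blast
    have "1 \<le> 2 * Y n * \<bar>eval_at \<xi> p\<bar>"
      using n(3) p(2) k(1) Y_mono[OF n(1)] by (intro eval_at_lower_at_scale) auto
    also have "\<dots> \<le> 2 * (B2 * H powr (2 * \<gamma> + 1)) * \<bar>eval_at \<xi> p\<bar>"
      using k2 Y_mono[OF n(2)] by (intro mult_right_mono mult_left_mono) auto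
    finally show ?thesis using B2 by (simp add: field_simps)
  qed
  moreover have "1 / (2 * B2) > 0" using B2 by simp
  ultimately show ?thesis by blast
qed

text \<open>For a linear polynomial \<open>P\<close> both \<open>P\<close> and \<open>T P\<close> can be paired with the same \<open>y k\<close>, and
  both scalar products vanish only if the determinant of \<open>y k\<close> does. No further steps are needed after reaching the scale, so the
  exponent is only \<open>\<gamma>\<close>.\<close>

lemma rational_lower_bound:
  "\<exists>a>0. \<forall>m n :: int. \<forall>H. n \<noteq> 0 \<longrightarrow> real_of_int \<bar>m\<bar> \<le> H \<longrightarrow> real_of_int \<bar>n\<bar> \<le> H \<longrightarrow> a \<le> \<bar>n * \<xi> - m\<bar> * H powr \<gamma>"
proof -
  obtain B where B: "B > 0" and scale: "\<And>H. H \<ge> 1 \<Longrightarrow> \<exists>k. 4 * C * H \<le> Y k \<and> Y k \<le> B * H powr \<gamma>"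
    using exists_scale[of "4 * C"] C_pos by auto
  define a where "a = 1 / (2 * B * (1 + \<bar>\<xi>\<bar>))"
  have a: "a > 0" using B by (simp add: a_def)
  have bound: "a \<le> \<bar>n * \<xi> - m\<bar> * H powr \<gamma>"
    if mn: "n \<noteq> 0" "real_of_int \<bar>m\<bar> \<le> H" "real_of_int \<bar>n\<bar> \<le> H" for m n :: int and H :: real
  proof -
    have "1 \<le> \<bar>real_of_int n\<bar>" using mn(1) by linarith
    then have H: "H \<ge> 1" using mn(3) by linarith
    obtain k where k: "4 * C * H \<le> Y k" "Y k \<le> B * H powr \<gamma>" using scale[OF H] by blast
    have norms: "max_norm (- m, n, 0) \<le> H" "max_norm (0, - m, n) \<le> H" using mn H by auto
    have ev: "eval_at \<xi> (- m, n, 0) = n * \<xi> - m" "eval_at \<xi> (0, - m, n) = \<xi> * (n * \<xi> - m)"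
      by (simp_all add: algebra_simps power2_eq_square)
    have "dot (- m, n, 0) (y k) \<noteq> 0 \<or> dot (0, - m, n) (y k) \<noteq> 0"
    proof (rule ccontr)
      assume *: "\<not> ?thesis"
      obtain y0 y1 y2 where yk: "y k = (y0, y1, y2)" by (cases "y k")
      have e: "n * y1 = m * y0" "n * y2 = m * y1" using * by (simp_all add: yk)
      have "n * (y0 * y2 - y1\<^sup>2) = y0 * (n * y2) - y1 * (n * y1)" by (simp add: algebra_simps power2_eq_square)
      also have "\<dots> = 0" unfolding e by (simp add: algebra_simps)
      finally show False using mn(1) det2[of k] by (simp add: yk)
    qed
    then have "1 \<le> 2 * Y k * \<bar>n * \<xi> - m\<bar> \<or> 1 \<le> 2 * Y k * \<bar>\<xi> * (n * \<xi> - m)\<bar>"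
      using eval_at_lower_at_scale[OF _ norms(1) k(1)] eval_at_lower_at_scale[OF _ norms(2) k(1)]
      unfolding ev by blast
    moreover have "\<bar>n * \<xi> - m\<bar> \<le> (1 + \<bar>\<xi>\<bar>) * \<bar>n * \<xi> - m\<bar>"
      "\<bar>\<xi> * (n * \<xi> - m)\<bar> \<le> (1 + \<bar>\<xi>\<bar>) * \<bar>n * \<xi> - m\<bar>"
      by (simp_all add: abs_mult distrib_right)
    then have "2 * Y k * \<bar>n * \<xi> - m\<bar> \<le> 2 * Y k * ((1 + \<bar>\<xi>\<bar>) * \<bar>n * \<xi> - m\<bar>)"
      "2 * Y k * \<bar>\<xi> * (n * \<xi> - m)\<bar> \<le> 2 * Y k * ((1 + \<bar>\<xi>\<bar>) * \<bar>n * \<xi> - m\<bar>)"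
      using Y_pos[of k] by (simp_all add: mult_left_mono)
    ultimately have "1 \<le> 2 * Y k * ((1 + \<bar>\<xi>\<bar>) * \<bar>n * \<xi> - m\<bar>)" by linarith
    also have "\<dots> \<le> 2 * (B * H powr \<gamma>) * ((1 + \<bar>\<xi>\<bar>) * \<bar>n * \<xi> - m\<bar>)"
      using k(2) by (intro mult_right_mono mult_left_mono) auto
    also have "\<dots> = (2 * B * (1 + \<bar>\<xi>\<bar>)) * (\<bar>n * \<xi> - m\<bar> * H powr \<gamma>)" by simp
    finally have "1 \<le> (2 * B * (1 + \<bar>\<xi>\<bar>)) * (\<bar>n * \<xi> - m\<bar> * H powr \<gamma>)" .
    moreover have pos: "2 * B * (1 + \<bar>\<xi>\<bar>) > 0" by (intro mult_pos_pos B add_pos_nonneg) auto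
    ultimately show ?thesis unfolding a_def pos_divide_le_eq[OF pos] by (simp only: mult.commute)
  qed
  show ?thesis by (intro exI[of _ a] conjI allI impI a bound)
qed

text \<open>With \<open>P\<close> the minimal polynomial, \<open>P(\<xi>) = P(\<xi>) - P(\<alpha>)\<close> is \<open>\<xi> - \<alpha>\<close> times a factor of order at most
  \<open>H\<close>, and \<open>|P(\<xi>)|\<close> is at least of order \<open>H\<^bsup>-(2\<gamma>+1)\<^esup>\<close>; finally \<open>2 \<gamma> + 2 = 2 \<gamma>\<^sup>2\<close>.\<close>

lemma quadratic_lower_bound:
  "\<exists>c>0. \<forall>\<alpha>::complex. algebraic \<alpha> \<longrightarrow> alg_degree \<alpha> \<le> 2 \<longrightarrow>
     c * alg_height \<alpha> powr (- 2 * \<gamma>\<^sup>2) < cmod (of_real \<xi> - \<alpha>)"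
proof -
  obtain a where a: "a > 0" and lower: "\<And>p H. p \<noteq> (0, 0, 0) \<Longrightarrow> max_norm p \<le> H \<Longrightarrow>
      a \<le> \<bar>eval_at \<xi> p\<bar> * H powr (2 * \<gamma> + 1)"
    using eval_at_lower_bound by blast
  define K where "K = 2 + 2 * \<bar>\<xi>\<bar>"
  have K: "K > 0" unfolding K_def by (intro add_pos_nonneg) auto
  define c where "c = min 1 (a / (2 * K))"
  have c: "c > 0" "c \<le> 1" using a K by (auto simp: c_def)
  have cK: "c * K < a"
  proof -
    have "c * K \<le> a / (2 * K) * K" using K by (intro mult_right_mono) (auto simp: c_def)
    also have "\<dots> = a / 2" using K by simp
    also have "\<dots> < a" using a by simp
    finally show ?thesis .
  qed
  have "c * alg_height \<alpha> powr (- 2 * \<gamma>\<^sup>2) < cmod (of_real \<xi> - \<alpha>)"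
    if \<alpha>: "algebraic \<alpha>" "alg_degree \<alpha> \<le> 2" for \<alpha> :: complex
  proof (rule ccontr)
    assume "\<not> ?thesis"
    then have le: "cmod (of_real \<xi> - \<alpha>) \<le> c * alg_height \<alpha> powr (- 2 * \<gamma>\<^sup>2)" by simp
    define H where "H = alg_height \<alpha>"
    have H1: "H \<ge> 1" unfolding H_def by (rule alg_height_ge_coeff(2)[OF \<alpha>(1)])
    let ?p = "irred_int_poly \<alpha>"
    define p0 p1 p2 where p: "p0 = coeff ?p 0" "p1 = coeff ?p 1" "p2 = coeff ?p 2"
    have coeffs: "\<bar>real_of_int p0\<bar> \<le> H" "\<bar>real_of_int p1\<bar> \<le> H" "\<bar>real_of_int p2\<bar> \<le> H"
      using alg_height_ge_coeff(1)[OF \<alpha>(1)] unfolding p H_def of_int_abs by blast+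
    have poly_eq: "?p = [:p0, p1, p2:]" using \<alpha>(2) unfolding p alg_degree_def by (rule poly_degree_le_2)
    have irr: "is_irred_int_poly_of \<alpha> ?p" by (rule irred_int_poly_is_irred[OF \<alpha>(1)])
    then have nz: "(p0, p1, p2) \<noteq> (0, 0, 0)" unfolding is_irred_int_poly_of_def poly_eq by auto
    have root: "of_int p0 + of_int p1 * \<alpha> + of_int p2 * \<alpha>\<^sup>2 = 0"
    proof -
      have "poly (map_poly of_int [:p0, p1, p2:]) \<alpha> = 0"
        using irr by (simp only: is_irred_int_poly_of_def poly_eq)
      then show ?thesis by (simp add: map_poly_pCons power2_eq_square algebra_simps)
    qed
    have close: "cmod (of_real \<xi> - \<alpha>) \<le> 1"
    proof -
      have "H powr (- 2 * \<gamma>\<^sup>2) \<le> H powr 0" using H1 by (intro powr_mono) auto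
      then have "c * H powr (- 2 * \<gamma>\<^sup>2) \<le> 1 * 1" using c H1 by (intro mult_mono) auto
      with le show ?thesis by (simp add: H_def)
    qed
    have "cmod \<alpha> \<le> \<bar>\<xi>\<bar> + 1"
      using norm_triangle_ineq4[of "of_real \<xi>" "of_real \<xi> - \<alpha>"] close by simp
    then have s: "cmod (of_real \<xi> + \<alpha>) \<le> 2 * \<bar>\<xi>\<bar> + 1"
      using norm_triangle_ineq[of "of_real \<xi>" \<alpha>] by simp
    have "cmod (of_int p1 + of_int p2 * (of_real \<xi> + \<alpha>)) \<le> \<bar>p1\<bar> + \<bar>p2\<bar> * cmod (of_real \<xi> + \<alpha>)"
      using norm_triangle_ineq[of "of_int p1" "of_int p2 * (of_real \<xi> + \<alpha>)"] by (simp add: norm_mult)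
    also have "\<dots> \<le> H + H * (2 * \<bar>\<xi>\<bar> + 1)" using coeffs s H1 by (intro add_mono mult_mono) auto
    also have "\<dots> = K * H" by (simp add: K_def algebra_simps)
    finally have slope: "cmod (of_int p1 + of_int p2 * (of_real \<xi> + \<alpha>)) \<le> K * H" .
    have "of_real (eval_at \<xi> (p0, p1, p2)) = (of_int p0 + of_int p1 * of_real \<xi> + of_int p2 * (of_real \<xi>)\<^sup>2)
       - (of_int p0 + of_int p1 * \<alpha> + of_int p2 * \<alpha>\<^sup>2)" unfolding root by simp
    also have "\<dots> = (of_real \<xi> - \<alpha>) * (of_int p1 + of_int p2 * (of_real \<xi> + \<alpha>))"
      by (simp add: algebra_simps power2_eq_square)
    finally have ev: "\<bar>eval_at \<xi> (p0, p1, p2)\<bar> = cmod (of_real \<xi> - \<alpha>) * cmod (of_int p1 + of_int p2 * (of_real \<xi> + \<alpha>))"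
      by (metis norm_mult norm_of_real)
    have norm: "max_norm (p0, p1, p2) \<le> H" using coeffs by simp
    have "a \<le> \<bar>eval_at \<xi> (p0, p1, p2)\<bar> * H powr (2 * \<gamma> + 1)" by (rule lower[OF nz norm])
    also have "\<dots> \<le> (c * H powr (- 2 * \<gamma>\<^sup>2)) * (K * H) * H powr (2 * \<gamma> + 1)"
      unfolding ev using le slope c by (intro mult_right_mono mult_mono) (auto simp: H_def)
    also have "\<dots> = c * K * (H powr (- 2 * \<gamma>\<^sup>2) * H powr 1 * H powr (2 * \<gamma> + 1))" using H1 by simp
    also have "H powr (- 2 * \<gamma>\<^sup>2) * H powr 1 * H powr (2 * \<gamma> + 1) = 1"
      unfolding powr_add[symmetric] using H1 by (simp add: golden_ratio_square)
    finally show False using cK by simp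
  qed
  with c(1) show ?thesis by blast
qed

section \<open>Quadratic numbers close to an extremal number\<close>

text \<open>The determinant of three consecutive points is nonzero, and the term with the largest size
  dominates its upper bound. In particular the ratios of consecutive sizes tend to infinity.\<close>

lemma size_product_le: "Y k * Y (Suc k) \<le> 6 * C\<^sup>2 * Y (Suc (Suc k))"
proof -
  let ?u = "y k" and ?v = "y (Suc k)" and ?w = "y (Suc (Suc k))"
  let ?R = "Y (Suc (Suc k)) * (C / Y k) * (C / Y (Suc k))"
  have m: "Y k \<le> Y (Suc k)" "Y (Suc k) \<le> Y (Suc (Suc k))" "Y k \<le> Y (Suc (Suc k))"
    by (intro Y_mono; simp)+
  have d: "C / Y (Suc k) \<le> C / Y k" "C / Y (Suc (Suc k)) \<le> C / Y (Suc k)"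
    using m C_pos Y_pos by (auto intro!: divide_left_mono)
  have nn: "0 \<le> C / Y j" for j using C_pos Y_pos[of j] by simp
  have 1: "Y k * err \<xi> ?v * err \<xi> ?w \<le> ?R"
    using m d nn C_pos Y_pos err_nonneg order_trans[OF err_y_le d(1)] order_trans[OF err_y_le d(2)]
    by (intro mult_mono) (auto simp: less_imp_le zero_le_divide_iff zero_le_mult_iff)
  have 2: "Y (Suc k) * err \<xi> ?u * err \<xi> ?w \<le> ?R"
    using m d nn C_pos Y_pos err_nonneg err_y_le order_trans[OF err_y_le d(2)]
    by (intro mult_mono) (auto simp: less_imp_le zero_le_divide_iff zero_le_mult_iff)
  have 3: "Y (Suc (Suc k)) * err \<xi> ?u * err \<xi> ?v \<le> ?R"
    using nn C_pos Y_pos err_nonneg err_y_le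
    by (intro mult_mono) (auto simp: less_imp_le zero_le_divide_iff zero_le_mult_iff)
  have "1 \<le> \<bar>real_of_int (det3 ?u ?v ?w)\<bar>" using det3[of k] by linarith
  also have "\<dots> \<le> 2 * (Y k * err \<xi> ?v * err \<xi> ?w + Y (Suc k) * err \<xi> ?u * err \<xi> ?w
      + Y (Suc (Suc k)) * err \<xi> ?u * err \<xi> ?v)"
    using abs_det3_le[of ?u ?v ?w \<xi>] by simp
  also have "\<dots> \<le> 2 * (?R + ?R + ?R)" by (intro mult_left_mono add_mono 1 2 3) simp
  also have "2 * (?R + ?R + ?R) = 6 * C\<^sup>2 * Y (Suc (Suc k)) / (Y k * Y (Suc k))" by (simp add: power2_eq_square)
  finally show ?thesis using mult_pos_pos[OF Y_pos[of k] Y_pos[of "Suc k"]] by (simp add: le_divide_eq)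
qed

lemma ratio_unbounded: "\<exists>k0. \<forall>k\<ge>k0. K * Y k \<le> Y (Suc k)"
proof -
  obtain n :: nat where n: "\<bar>K\<bar> * (6 * C\<^sup>2) \<le> real n" using real_arch_simple by blast
  have "K * Y k \<le> Y (Suc k)" if k: "k \<ge> Suc n" for k
  proof -
    obtain j where j: "k = Suc j" using k by (cases k) auto
    have "\<bar>K\<bar> * (6 * C\<^sup>2) \<le> Y j" using n Y_ge[of j] k j by simp
    then have "(\<bar>K\<bar> * (6 * C\<^sup>2)) * Y k \<le> Y j * Y k" using Y_pos[of k] by (intro mult_right_mono) auto
    also have "\<dots> \<le> 6 * C\<^sup>2 * Y (Suc k)" using size_product_le[of j] j by simp
    finally have "(6 * C\<^sup>2) * (\<bar>K\<bar> * Y k) \<le> (6 * C\<^sup>2) * Y (Suc k)" by (simp only: mult_ac)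
    moreover have "6 * C\<^sup>2 > 0" using C_pos by simp
    ultimately have "\<bar>K\<bar> * Y k \<le> Y (Suc k)" by (metis mult_le_cancel_left_pos)
    moreover have "K * Y k \<le> \<bar>K\<bar> * Y k" using Y_pos[of k] by (intro mult_right_mono) auto
    ultimately show ?thesis by linarith
  qed
  then show ?thesis by blast
qed

text \<open>The norm is of order at most \<open>Y\<^sub>k\<^sub>+\<^sub>1 / Y\<^sub>k\<close>, and the growth bound turns \<open>Y\<^sub>k\<close> into a multiple of
  \<open>Y\<^sub>k\<^sub>+\<^sub>1\<^bsup>\<gamma>-1\<^esup>\<close>.\<close>

lemma max_norm_cross_y_le:
  "\<exists>D>0. \<forall>k. max_norm (cross (y k) (y (Suc k))) \<le> D * Y (Suc k) powr (2 - \<gamma>)"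
proof -
  define M where "M = 2 + \<bar>\<xi>\<bar> + \<xi>\<^sup>2"
  have M: "M > 0" unfolding M_def by (intro add_pos_nonneg) auto
  define D where "D = M * (2 * C + C\<^sup>2) * C powr (\<gamma> - 1)"
  have D: "D > 0" using M C_pos by (simp add: D_def add_pos_pos)
  have e: "\<gamma> * (\<gamma> - 1) = 1"
    using golden_ratio_square by (simp_all add: algebra_simps power2_eq_square)
  have "max_norm (cross (y k) (y (Suc k))) \<le> D * Y (Suc k) powr (2 - \<gamma>)" for k
  proof -
    let ?y = "y k" and ?z = "y (Suc k)" and ?r = "Y (Suc k) / Y k"
    have Yle: "Y k \<le> Y (Suc k)" by (rule Y_mono) simp
    have r1: "?r \<ge> 1" using Yle Y_pos[of k] by simp
    have a: "Y (Suc k) * err \<xi> ?y \<le> C * ?r"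
      using mult_left_mono[OF err_y_le[of k], of "Y (Suc k)"] Y_pos[of "Suc k"] by (simp add: mult.commute)
    have "Y k * err \<xi> ?z \<le> Y (Suc k) * err \<xi> ?z" using Yle err_nonneg by (rule mult_right_mono)
    also have "\<dots> \<le> C * 1" using size_err[of "Suc k"] by simp
    also have "\<dots> \<le> C * ?r" using r1 C_pos by (intro mult_left_mono) auto
    finally have b: "Y k * err \<xi> ?z \<le> C * ?r" .
    have ec: "err \<xi> (y j) \<le> C" for j
      using mult_right_mono[OF size_ge_1[of j] err_nonneg[of \<xi> "y j"]] size_err[of j] by simp
    have "err \<xi> ?y * err \<xi> ?z \<le> C * C" using ec err_nonneg C_pos by (intro mult_mono) auto
    also have "\<dots> = C\<^sup>2 * 1" by (simp add: power2_eq_square)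
    also have "\<dots> \<le> C\<^sup>2 * ?r" using r1 by (intro mult_left_mono) auto
    finally have c: "err \<xi> ?y * err \<xi> ?z \<le> C\<^sup>2 * ?r" .
    have "max_norm (cross ?y ?z) \<le> M * (Y k * err \<xi> ?z + Y (Suc k) * err \<xi> ?y + err \<xi> ?y * err \<xi> ?z)"
      unfolding M_def by (rule max_norm_cross_le)
    also have "\<dots> \<le> M * (C * ?r + C * ?r + C\<^sup>2 * ?r)" using M by (intro mult_left_mono add_mono a b c) simp
    also have "\<dots> = M * (2 * C + C\<^sup>2) * ?r" by (simp add: algebra_simps)
    also have "?r \<le> C powr (\<gamma> - 1) * Y (Suc k) powr (2 - \<gamma>)"
    proof -
      have "Y (Suc k) powr (\<gamma> - 1) \<le> (C * Y k powr \<gamma>) powr (\<gamma> - 1)"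
        using size_growth[of k] Y_pos[of "Suc k"] golden_ratio_gt_1 by (intro powr_mono2) auto
      also have "\<dots> = C powr (\<gamma> - 1) * Y k" using C_pos Y_pos[of k] by (simp add: powr_mult powr_powr e)
      finally have "Y (Suc k) powr (\<gamma> - 1) * Y (Suc k) powr (2 - \<gamma>) \<le> C powr (\<gamma> - 1) * Y k * Y (Suc k) powr (2 - \<gamma>)"
        by (intro mult_right_mono) auto
      moreover have "Y (Suc k) powr (\<gamma> - 1) * Y (Suc k) powr (2 - \<gamma>) = Y (Suc k)"
        using Y_pos[of "Suc k"] by (simp flip: powr_add)
      ultimately show ?thesis using Y_pos[of k] by (simp add: divide_le_eq mult_ac)
    qed
    finally show ?thesis using M C_pos by (simp add: D_def mult_left_mono mult.assoc)
  qed
  with D show ?thesis by blast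
qed

text \<open>Value at most of order \<open>1 / (Y\<^sub>k Y\<^sub>k\<^sub>+\<^sub>1)\<close> and derivative at least of order \<open>Y\<^sub>k\<^sub>+\<^sub>1 / Y\<^sub>k\<close> place a root at
  distance at most of order \<open>1 / Y\<^sub>k\<^sub>+\<^sub>1\<^sup>2\<close>.\<close>

lemma root_near_of_cross:
  "\<exists>k0. \<forall>k\<ge>k0. \<exists>q0 q1 q2 (\<alpha>::complex). cross (y k) (y (Suc k)) = (q0, q1, q2) \<and> q1 + 2 * \<xi> * q2 \<noteq> 0 \<and>
     of_int q0 + of_int q1 * \<alpha> + of_int q2 * \<alpha>\<^sup>2 = 0 \<and> cmod (of_real \<xi> - \<alpha>) * (Y (Suc k))\<^sup>2 \<le> 8 * C\<^sup>2"
proof -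
  \<comment> \<open>Once \<open>K Y\<^sub>k \<le> Y\<^sub>k\<^sub>+\<^sub>1\<close>, the error term in \<open>deriv_cross_ge\<close> is at most \<open>Y\<^sub>k\<^sub>+\<^sub>1\<close>, a third of its left-hand side.\<close>
  define K where "K = 1 + 4 * (1 + 2 * \<bar>\<xi>\<bar>) * C"
  have K1: "K \<ge> 1" using C_pos by (simp add: K_def)
  obtain k1 where k1: "\<And>k. k \<ge> k1 \<Longrightarrow> K * Y k \<le> Y (Suc k)" using ratio_unbounded[of K] by blast
  \<comment> \<open>Sizes of at least \<open>2 C\<close> have errors of at most \<open>1/2\<close>, as \<open>deriv_cross_ge\<close> requires.\<close>
  obtain n :: nat where n: "2 * C \<le> real n" using real_arch_simple by blast
  have "\<exists>q0 q1 q2 (\<alpha>::complex). cross (y k) (y (Suc k)) = (q0, q1, q2) \<and> q1 + 2 * \<xi> * q2 \<noteq> 0 \<and>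
     of_int q0 + of_int q1 * \<alpha> + of_int q2 * \<alpha>\<^sup>2 = 0 \<and> cmod (of_real \<xi> - \<alpha>) * (Y (Suc k))\<^sup>2 \<le> 8 * C\<^sup>2"
    if k: "k \<ge> max k1 n" for k
  proof -
    obtain q0 q1 q2 where q: "cross (y k) (y (Suc k)) = (q0, q1, q2)" by (cases "cross (y k) (y (Suc k))")
    let ?Y = "Y k" and ?Z = "Y (Suc k)" and ?d = "\<bar>q1 + 2 * \<xi> * q2\<bar>"
    have KY: "K * ?Y \<le> ?Z" using k1 k by simp
    have "2 * C \<le> ?Y" using n k Y_ge[of k] by simp
    then have "2 * C * err \<xi> (y k) \<le> C"
      using mult_right_mono[OF _ err_nonneg[of \<xi> "y k"], of "2 * C" ?Y] size_err[of k] by linarith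
    then have half: "err \<xi> (y k) \<le> 1 / 2" using C_pos by (simp add: field_simps)
    have "4 * (1 + 2 * \<bar>\<xi>\<bar>) * ?Y\<^sup>2 * err \<xi> (y (Suc k)) \<le> ?Z"
    proof -
      have "K * ?Y\<^sup>2 \<le> ?Z * ?Y" using mult_right_mono[OF KY, of ?Y] Y_pos[of k] by (simp add: power2_eq_square)
      also have "\<dots> \<le> ?Z * ?Z" using Y_mono[of k "Suc k"] Y_pos[of "Suc k"] by (intro mult_left_mono) auto
      finally have KY2: "K * ?Y\<^sup>2 \<le> ?Z * ?Z" .
      have "?Z * (4 * (1 + 2 * \<bar>\<xi>\<bar>) * ?Y\<^sup>2 * err \<xi> (y (Suc k))) = 4 * (1 + 2 * \<bar>\<xi>\<bar>) * ?Y\<^sup>2 * (?Z * err \<xi> (y (Suc k)))"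
        by simp
      also have "\<dots> \<le> 4 * (1 + 2 * \<bar>\<xi>\<bar>) * ?Y\<^sup>2 * C" using size_err[of "Suc k"] by (intro mult_left_mono) auto
      also have "\<dots> = (4 * (1 + 2 * \<bar>\<xi>\<bar>) * C) * ?Y\<^sup>2" by simp
      also have "\<dots> \<le> K * ?Y\<^sup>2" by (intro mult_right_mono) (auto simp: K_def)
      also note KY2
      finally show ?thesis using Y_pos[of "Suc k"] by (metis mult_le_cancel_left_pos)
    qed
    then have d: "?Z \<le> 2 * ?Y * ?d" using deriv_cross_ge[OF q det2 half] by linarith
    have d0: "q1 + 2 * \<xi> * q2 \<noteq> 0" using d Y_pos[of "Suc k"] by auto
    obtain \<alpha> :: complex where \<alpha>: "of_real q0 + of_real q1 * \<alpha> + of_real q2 * \<alpha>\<^sup>2 = 0"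
      "cmod (of_real \<xi> - \<alpha>) * ?d \<le> 2 * \<bar>q0 + q1 * \<xi> + q2 * \<xi>\<^sup>2\<bar>"
      using complex_root_near[OF d0] by blast
    have "\<bar>q0 + q1 * \<xi> + q2 * \<xi>\<^sup>2\<bar> \<le> 2 * err \<xi> (y k) * err \<xi> (y (Suc k))"
      using eval_at_cross_le[of \<xi> "y k" "y (Suc k)"] by (simp add: q)
    from mult_left_mono[OF this, of 2] have a1: "cmod (of_real \<xi> - \<alpha>) * ?d \<le> 4 * (err \<xi> (y k) * err \<xi> (y (Suc k)))"
      using \<alpha>(2) by simp
    have "cmod (of_real \<xi> - \<alpha>) * ?Z\<^sup>2 = cmod (of_real \<xi> - \<alpha>) * ?Z * ?Z" by (simp add: power2_eq_square)
    also have "\<dots> \<le> cmod (of_real \<xi> - \<alpha>) * (2 * ?Y * ?d) * ?Z"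
      using d Y_pos[of "Suc k"] by (intro mult_right_mono mult_left_mono) auto
    also have "\<dots> = (2 * ?Y * ?Z) * (cmod (of_real \<xi> - \<alpha>) * ?d)" by simp
    also have "\<dots> \<le> (2 * ?Y * ?Z) * (4 * (err \<xi> (y k) * err \<xi> (y (Suc k))))"
      using Y_pos[of k] Y_pos[of "Suc k"] by (intro mult_left_mono a1) auto
    also have "\<dots> = 8 * ((?Y * err \<xi> (y k)) * (?Z * err \<xi> (y (Suc k))))" by simp
    also have "\<dots> \<le> 8 * (C * C)"
      using size_err[of k] size_err[of "Suc k"] C_pos Y_pos err_nonneg
      by (intro mult_left_mono mult_mono) (auto simp: zero_le_mult_iff less_imp_le)
    finally have "cmod (of_real \<xi> - \<alpha>) * ?Z\<^sup>2 \<le> 8 * C\<^sup>2" by (simp add: power2_eq_square)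
    with q d0 \<alpha>(1) show ?thesis by auto
  qed
  then show ?thesis by blast
qed

text \<open>The root from \<open>root_near_of_cross\<close> has the right distance. Were it a rational number \<open>u / v\<close> in lowest terms,
  \<open>v\<close> would divide a nonzero coefficient, so \<open>u\<close> and \<open>v\<close> would be at most of order \<open>N\<close>, the norm of the polynomial, and
  \<open>rational_lower_bound\<close> would contradict \<open>|v \<xi> - u| \<le> N |\<xi> - \<alpha>|\<close> for large \<open>k\<close>.\<close>

lemma close_quadratic_numbers:
  "\<exists>c>0. \<exists>k0. \<forall>k\<ge>k0. \<exists>\<alpha>::complex. algebraic \<alpha> \<and> alg_degree \<alpha> = 2 \<and>
     cmod (of_real \<xi> - \<alpha>) \<le> c * alg_height \<alpha> powr (- 2 * \<gamma>\<^sup>2) \<and>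
     cmod (of_real \<xi> - \<alpha>) * Y k \<le> 8 * C\<^sup>2"
proof -
  obtain D where D: "D > 0" and norm: "\<And>k. max_norm (cross (y k) (y (Suc k))) \<le> D * Y (Suc k) powr (2 - \<gamma>)"
    using max_norm_cross_y_le by blast
  obtain k1 where root: "\<And>k. k \<ge> k1 \<Longrightarrow> \<exists>q0 q1 q2 (\<alpha>::complex). cross (y k) (y (Suc k)) = (q0, q1, q2) \<and>
     q1 + 2 * \<xi> * q2 \<noteq> 0 \<and> of_int q0 + of_int q1 * \<alpha> + of_int q2 * \<alpha>\<^sup>2 = 0 \<and>
     cmod (of_real \<xi> - \<alpha>) * (Y (Suc k))\<^sup>2 \<le> 8 * C\<^sup>2"
    using root_near_of_cross by blast
  obtain a where a: "a > 0" and rat: "\<And>(m::int) (n::int) H. n \<noteq> 0 \<Longrightarrow> real_of_int \<bar>m\<bar> \<le> H \<Longrightarrow> real_of_int \<bar>n\<bar> \<le> H \<Longrightarrow> a \<le> \<bar>n * \<xi> - m\<bar> * H powr \<gamma>"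
    using rational_lower_bound by blast
  have e: "(2 - \<gamma>) * (\<gamma> + 1) = 1"
    using golden_ratio_square by (simp_all add: algebra_simps power2_eq_square)
  \<comment> \<open>A rational root would force \<open>Y (Suc k) \<le> R\<close>. A size above \<open>8 * C\<^sup>2\<close> puts \<open>\<alpha>\<close> within distance 1 of \<open>\<xi>\<close>.\<close>
  define R where "R = 8 * C\<^sup>2 * (\<bar>\<xi>\<bar> + 1) powr \<gamma> * D powr (\<gamma> + 1) / a"
  obtain n where n: "max R (8 * C\<^sup>2) \<le> real n" using real_arch_simple by blast
  define c where "c = 8 * C\<^sup>2 * D powr (2 * \<gamma>\<^sup>2)"
  have c: "c > 0" using C_pos D by (simp add: c_def)
  have "\<exists>\<alpha>::complex. algebraic \<alpha> \<and> alg_degree \<alpha> = 2 \<and>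
     cmod (of_real \<xi> - \<alpha>) \<le> c * alg_height \<alpha> powr (- 2 * \<gamma>\<^sup>2) \<and> cmod (of_real \<xi> - \<alpha>) * Y k \<le> 8 * C\<^sup>2"
    if k: "k \<ge> max k1 n" for k
  proof -
    let ?Z = "Y (Suc k)" and ?q = "cross (y k) (y (Suc k))"
    define N where "N = max_norm ?q"
    obtain q0 q1 q2 and \<alpha> :: complex where q: "?q = (q0, q1, q2)" and d: "q1 + 2 * \<xi> * q2 \<noteq> 0"
      and \<alpha>: "of_int q0 + of_int q1 * \<alpha> + of_int q2 * \<alpha>\<^sup>2 = 0"
      and near: "cmod (of_real \<xi> - \<alpha>) * ?Z\<^sup>2 \<le> 8 * C\<^sup>2"
      using root[of k] k by auto
    have qnz: "?q \<noteq> (0, 0, 0)" using d q by auto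
    have N1: "N \<ge> 1" unfolding N_def by (rule max_norm_ge_1[OF qnz])
    have NZ: "N \<le> D * ?Z powr (2 - \<gamma>)" using norm[of k] by (simp add: N_def)
    have Zn: "R < ?Z" "8 * C\<^sup>2 < ?Z" using n k Y_ge[of "Suc k"] by simp_all
    have Z1: "?Z \<ge> 1" by (rule size_ge_1)
    have near1: "cmod (of_real \<xi> - \<alpha>) * ?Z \<le> 8 * C\<^sup>2"
    proof -
      have "cmod (of_real \<xi> - \<alpha>) * ?Z * 1 \<le> cmod (of_real \<xi> - \<alpha>) * ?Z * ?Z"
        using Z1 by (intro mult_left_mono) auto
      with near show ?thesis by (simp add: power2_eq_square)
    qed
    have close: "cmod (of_real \<xi> - \<alpha>) \<le> 1"
    proof (rule ccontr)
      assume "\<not> ?thesis"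
      then have "1 * ?Z \<le> cmod (of_real \<xi> - \<alpha>) * ?Z" using Z1 by (intro mult_right_mono) auto
      with near1 Zn(2) show False by linarith
    qed
    define p where "p = [:q0, q1, q2:]"
    have p0: "p \<noteq> 0" using qnz q by (auto simp: p_def)
    have pr: "poly (map_poly of_int p) \<alpha> = 0"
      using \<alpha> by (simp add: p_def map_poly_pCons power2_eq_square algebra_simps)
    have deg_p: "degree p \<le> 2" by (simp add: p_def)
    have alg: "algebraic \<alpha>" and le: "alg_degree \<alpha> \<le> 2" using alg_degree_le[OF p0 pr] deg_p by auto
    have "alg_degree \<alpha> \<noteq> 1"
    proof
      assume "alg_degree \<alpha> = 1"
      then obtain u v :: int where v: "v > 0" and cop: "coprime u v" and uv: "of_int v * \<alpha> = of_int u"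
        using rational_if_alg_degree_1[OF alg] by blast
      have "of_int (q0 * v\<^sup>2 + q1 * u * v + q2 * u\<^sup>2) = (of_int v)\<^sup>2 * (of_int q0 + of_int q1 * \<alpha> + of_int q2 * \<alpha>\<^sup>2)"
        by (simp add: uv[symmetric] algebra_simps power2_eq_square)
      then have eq: "q0 * v\<^sup>2 + q1 * u * v + q2 * u\<^sup>2 = 0" unfolding \<alpha> by (metis mult_zero_right of_int_eq_0_iff)
      have v_le: "real_of_int \<bar>v\<bar> \<le> N"
      proof (cases "q2 = 0")
        case False
        have "q2 * u\<^sup>2 = v * (- q0 * v - q1 * u)" using eq by (simp add: algebra_simps power2_eq_square)
        then have "v dvd q2 * u\<^sup>2" by (metis dvd_triv_left)
        then have "v dvd q2" using cop by (metis coprime_commute coprime_dvd_mult_left_iff coprime_power_right_iff zero_less_numeral)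
        then have "\<bar>v\<bar> \<le> \<bar>q2\<bar>" using False by (simp add: dvd_imp_le_int)
        then show ?thesis using abs_coord_le_max_norm(3)[of q2 q0 q1] unfolding N_def q by linarith
      next
        case True
        then have q1: "q1 \<noteq> 0" using d by auto
        have "v * (q0 * v + q1 * u) = 0" using eq True by (simp add: algebra_simps power2_eq_square)
        then have "q0 * v + q1 * u = 0" using v by simp
        then have "q1 * u = v * (- q0)" by (simp add: algebra_simps)
        then have "v dvd q1 * u" by (metis dvd_triv_left)
        then have "v dvd q1" using cop by (metis coprime_commute coprime_dvd_mult_left_iff)
        then have "\<bar>v\<bar> \<le> \<bar>q1\<bar>" using q1 by (simp add: dvd_imp_le_int)
        then show ?thesis using abs_coord_le_max_norm(2)[of q1 q0 q2] unfolding N_def q by linarith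
      qed
      let ?H = "(\<bar>\<xi>\<bar> + 1) * N"
      have "cmod \<alpha> \<le> \<bar>\<xi>\<bar> + 1"
        using norm_triangle_ineq4[of "of_real \<xi>" "of_real \<xi> - \<alpha>"] close by simp
      then have "cmod (of_int v * \<alpha>) \<le> N * (\<bar>\<xi>\<bar> + 1)" using v_le by (simp add: norm_mult mult_mono)
      then have u_le: "real_of_int \<bar>u\<bar> \<le> ?H" unfolding uv by (simp add: mult.commute)
      have "1 * N \<le> ?H" using N1 by (intro mult_right_mono) auto
      then have v_le': "real_of_int \<bar>v\<bar> \<le> ?H" using v_le by linarith
      have "complex_of_real (v * \<xi> - u) = of_int v * (of_real \<xi> - \<alpha>)" using uv by (simp add: algebra_simps)
      then have "\<bar>v * \<xi> - u\<bar> = \<bar>v\<bar> * cmod (of_real \<xi> - \<alpha>)" by (metis norm_mult norm_of_int norm_of_real of_int_abs)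
      also have "\<dots> \<le> N * cmod (of_real \<xi> - \<alpha>)" using v_le by (intro mult_right_mono) auto
      finally have lin: "\<bar>v * \<xi> - u\<bar> \<le> N * cmod (of_real \<xi> - \<alpha>)" .
      have "a \<le> \<bar>v * \<xi> - u\<bar> * ?H powr \<gamma>" using rat[of v u ?H] v u_le v_le' by simp
      also have "\<dots> \<le> N * cmod (of_real \<xi> - \<alpha>) * ?H powr \<gamma>" using lin by (intro mult_right_mono) auto
      also have "\<dots> = cmod (of_real \<xi> - \<alpha>) * (\<bar>\<xi>\<bar> + 1) powr \<gamma> * (N powr 1 * N powr \<gamma>)"
        using N1 by (simp add: powr_mult)
      also have "N powr 1 * N powr \<gamma> = N powr (\<gamma> + 1)" unfolding powr_add[symmetric] by (simp add: add.commute)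
      also have "\<dots> \<le> (D * ?Z powr (2 - \<gamma>)) powr (\<gamma> + 1)"
        using NZ N1 golden_ratio_gt_1 by (intro powr_mono2) auto
      also have "\<dots> = D powr (\<gamma> + 1) * ?Z" using D Z1 by (simp add: powr_mult powr_powr e)
      finally have "a \<le> cmod (of_real \<xi> - \<alpha>) * (\<bar>\<xi>\<bar> + 1) powr \<gamma> * (D powr (\<gamma> + 1) * ?Z)"
        by (simp add: mult_left_mono)
      then have "a * ?Z \<le> cmod (of_real \<xi> - \<alpha>) * (\<bar>\<xi>\<bar> + 1) powr \<gamma> * (D powr (\<gamma> + 1) * ?Z) * ?Z"
        using Z1 by (intro mult_right_mono) auto
      also have "\<dots> = (cmod (of_real \<xi> - \<alpha>) * ?Z\<^sup>2) * ((\<bar>\<xi>\<bar> + 1) powr \<gamma> * D powr (\<gamma> + 1))"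
        by (simp add: power2_eq_square)
      also have "\<dots> \<le> (8 * C\<^sup>2) * ((\<bar>\<xi>\<bar> + 1) powr \<gamma> * D powr (\<gamma> + 1))" by (intro mult_right_mono near) auto
      also have "\<dots> = a * R" using a by (simp add: R_def)
      finally have "?Z \<le> R" using a by simp
      with Zn(1) show False by linarith
    qed
    then have deg: "alg_degree \<alpha> = 2" using alg_degree_pos[OF alg] le by linarith
    have "alg_height \<alpha> \<le> N"
    proof (rule alg_height_le[OF p0 pr])
      show "degree p \<le> alg_degree \<alpha>" using deg deg_p by simp
      have "real_of_int \<bar>q0\<bar> \<le> N" "real_of_int \<bar>q1\<bar> \<le> N" "real_of_int \<bar>q2\<bar> \<le> N"
        unfolding N_def q of_int_abs by (rule abs_coord_le_max_norm)+
      then show "real_of_int \<bar>coeff p i\<bar> \<le> N" for i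
        using N1 unfolding p_def by (simp add: coeff_pCons split: nat.split)
    qed
    then have h: "alg_height \<alpha> \<le> D * ?Z powr (2 - \<gamma>)" using NZ by linarith
    have h1: "1 \<le> alg_height \<alpha>" by (rule alg_height_ge_coeff(2)[OF alg])
    have "alg_height \<alpha> powr (2 * \<gamma>\<^sup>2) \<le> (D * ?Z powr (2 - \<gamma>)) powr (2 * \<gamma>\<^sup>2)"
      using h h1 by (intro powr_mono2) auto
    also have "\<dots> = D powr (2 * \<gamma>\<^sup>2) * ?Z powr ((2 - \<gamma>) * (2 * \<gamma>\<^sup>2))"
      using D Z1 by (simp add: powr_mult powr_powr)
    also have "(2 - \<gamma>) * (2 * \<gamma>\<^sup>2) = 2 * ((2 - \<gamma>) * (\<gamma> + 1))"
      unfolding golden_ratio_square by (simp only: mult_ac)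
    also have "?Z powr (2 * ((2 - \<gamma>) * (\<gamma> + 1))) = ?Z\<^sup>2" using Z1 by (simp add: e)
    finally have "cmod (of_real \<xi> - \<alpha>) * alg_height \<alpha> powr (2 * \<gamma>\<^sup>2) \<le> cmod (of_real \<xi> - \<alpha>) * (D powr (2 * \<gamma>\<^sup>2) * ?Z\<^sup>2)"
      by (intro mult_left_mono) auto
    also have "\<dots> = D powr (2 * \<gamma>\<^sup>2) * (cmod (of_real \<xi> - \<alpha>) * ?Z\<^sup>2)" by simp
    also have "\<dots> \<le> D powr (2 * \<gamma>\<^sup>2) * (8 * C\<^sup>2)" by (intro mult_left_mono near) auto
    finally have fin: "cmod (of_real \<xi> - \<alpha>) * alg_height \<alpha> powr (2 * \<gamma>\<^sup>2) \<le> c" by (simp add: c_def mult.commute)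
    have "alg_height \<alpha> powr (- 2 * \<gamma>\<^sup>2) = 1 / alg_height \<alpha> powr (2 * \<gamma>\<^sup>2)"
      by (simp add: powr_minus_divide)
    then have "cmod (of_real \<xi> - \<alpha>) \<le> c * alg_height \<alpha> powr (- 2 * \<gamma>\<^sup>2)"
      using fin h1 by (simp add: le_divide_eq)
    moreover have "cmod (of_real \<xi> - \<alpha>) * Y k \<le> 8 * C\<^sup>2"
      using mult_left_mono[OF Y_mono[of k "Suc k"] norm_ge_zero[of "of_real \<xi> - \<alpha>"]] near1 by simp
    ultimately show ?thesis using alg deg by blast
  qed
  with c show ?thesis by blast
qed

text \<open>The roots found above converge to \<open>\<xi>\<close>, and by \<open>quadratic_lower_bound\<close> none of them equals \<open>\<xi>\<close>.\<close>

lemma infinitely_many_close_quadratics: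
  "\<exists>c>0. infinite {\<alpha>::complex. algebraic \<alpha> \<and> alg_degree \<alpha> = 2 \<and>
     cmod (of_real \<xi> - \<alpha>) \<le> c * alg_height \<alpha> powr (- 2 * \<gamma>\<^sup>2)}"
proof -
  obtain c k0 where c: "c > 0" and close: "\<And>k. k \<ge> k0 \<Longrightarrow> \<exists>\<alpha>::complex. algebraic \<alpha> \<and> alg_degree \<alpha> = 2 \<and>
     cmod (of_real \<xi> - \<alpha>) \<le> c * alg_height \<alpha> powr (- 2 * \<gamma>\<^sup>2) \<and>
     cmod (of_real \<xi> - \<alpha>) * Y k \<le> 8 * C\<^sup>2"
    using close_quadratic_numbers by blast
  obtain b where b: "b > 0" and lower: "\<And>\<alpha>::complex. algebraic \<alpha> \<Longrightarrow> alg_degree \<alpha> \<le> 2 \<Longrightarrow>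
     b * alg_height \<alpha> powr (- 2 * \<gamma>\<^sup>2) < cmod (of_real \<xi> - \<alpha>)"
    using quadratic_lower_bound by blast
  define S where "S = {\<alpha>::complex. algebraic \<alpha> \<and> alg_degree \<alpha> = 2 \<and>
     cmod (of_real \<xi> - \<alpha>) \<le> c * alg_height \<alpha> powr (- 2 * \<gamma>\<^sup>2)}"
  have "infinite S"
  proof
    assume fin: "finite S"
    define d where "d = Min (insert 1 ((\<lambda>\<alpha>. cmod (of_real \<xi> - \<alpha>)) ` S))"
    have "0 < cmod (of_real \<xi> - \<alpha>)" if "\<alpha> \<in> S" for \<alpha>
    proof -
      have "0 \<le> b * alg_height \<alpha> powr (- 2 * \<gamma>\<^sup>2)" using b by simp
      also have "\<dots> < cmod (of_real \<xi> - \<alpha>)" using that by (intro lower) (auto simp: S_def)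
      finally show ?thesis .
    qed
    then have d: "d > 0" using fin unfolding d_def by (subst Min_gr_iff) auto
    obtain n :: nat where n: "8 * C\<^sup>2 / d \<le> real n" using real_arch_simple by blast
    define k where "k = max k0 n"
    obtain \<alpha> where \<alpha>: "\<alpha> \<in> S" "cmod (of_real \<xi> - \<alpha>) * Y k \<le> 8 * C\<^sup>2"
      using close[of k] by (auto simp: k_def S_def)
    have "d \<le> cmod (of_real \<xi> - \<alpha>)" using fin \<alpha>(1) unfolding d_def by (intro Min_le) auto
    then have "d * Y k \<le> cmod (of_real \<xi> - \<alpha>) * Y k" using Y_pos[of k] by (intro mult_right_mono) auto
    also note \<alpha>(2)
    also have "8 * C\<^sup>2 \<le> d * real n" using n d by (simp add: divide_le_eq mult.commute)
    finally have "Y k \<le> real n" using d by simp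
    then show False using Y_ge[of k] by (simp add: k_def)
  qed
  with c show ?thesis unfolding S_def by blast
qed

end

theorem theorem1p4:
  fixes \<xi> :: real
  assumes "extremal \<xi>"
  shows "(\<exists>c::real. c > 0 \<and>
            infinite {\<alpha>::complex. algebraic \<alpha> \<and> alg_degree \<alpha> = 2 \<and>
              cmod (of_real \<xi> - \<alpha>) \<le> c * alg_height \<alpha> powr (- 2 * golden_ratio\<^sup>2)}) \<and>
         (\<exists>c::real. c > 0 \<and>
            \<not> (\<exists>\<alpha>::complex. algebraic \<alpha> \<and> alg_degree \<alpha> \<le> 2 \<and>
              cmod (of_real \<xi> - \<alpha>) \<le> c * alg_height \<alpha> powr (- 2 * golden_ratio\<^sup>2)))"
proof -
  obtain c x where "minimal_sequence \<xi> c x" using extremal_minimal_sequence[OF assms] by blast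
  then interpret minimal_sequence \<xi> c x .
  obtain C y where "extremal_sequence \<xi> C y" using extremal_sequence_of_turns by blast
  then interpret extremal_sequence \<xi> C y .
  obtain b where "b > 0" and b: "\<And>\<alpha>::complex. algebraic \<alpha> \<Longrightarrow> alg_degree \<alpha> \<le> 2 \<Longrightarrow>
     b * alg_height \<alpha> powr (- 2 * \<gamma>\<^sup>2) < cmod (of_real \<xi> - \<alpha>)"
    using quadratic_lower_bound by blast
  from b have "\<not> (\<exists>\<alpha>::complex. algebraic \<alpha> \<and> alg_degree \<alpha> \<le> 2 \<and>
              cmod (of_real \<xi> - \<alpha>) \<le> b * alg_height \<alpha> powr (- 2 * golden_ratio\<^sup>2))"
    using linorder_not_le by blast
  with infinitely_many_close_quadratics \<open>b > 0\<close> show ?thesis by blast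
qed

end
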